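(* Let $X\ge2$, $\varepsilon>0$, $D=X^{1-\varepsilon}$, and let $l_1,l_2:\mathbb{N}\to\mathbb{Z}$. Suppose that for at least one $i\in\{1,2\}$, $$\sum_{D<n\le X}\Big(\sum_{\substack{d\le D\\ n\equiv l_i(d)\bmod d}}1\Big)^2\ll X^{1+o(1)}.$$ Let $f_1,f_2$ be arithmetic functions with $|f_1|,|f_2|\le1$. Then for all integers $N\in(X/2,X]$ with $O(X^{1-\varepsilon/8})$ exceptions, $$\sum_{d_1,d_2\le D}f_1(d_1)f_2(d_2)\left(\sum_{\substack{m+n=N\\ m\equiv l_1(d_1)\bmod d_1\\ n\equiv l_2(d_2)\bmod d_2}}1-\frac{N}{[d_1,d_2]}\mathbf{1}_{l_1(d_1)+l_2(d_2)\equiv N\bmod (d_1,d_2)}\right)\ll X^{1-\varepsilon/8}.$$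
   Context: Sums over $m+n=N$ run over positive integers $m,n$. $[d_1,d_2]$ and $(d_1,d_2)$ denote lcm and gcd. *)

theory Defs
  imports Complex_Main "HOL-Number_Theory.Cong"
begin

definition second_moment :: "(nat \<Rightarrow> int) \<Rightarrow> real \<Rightarrow> real \<Rightarrow> real" where
  "second_moment l D X =
     (\<Sum>n | D < real n \<and> real n \<le> X.
        (\<Sum>d | 1 \<le> d \<and> real d \<le> D \<and> [int n = l d] (mod int d). 1)\<^sup>2)"

definition representation_count ::
  "(nat \<Rightarrow> int) \<Rightarrow> (nat \<Rightarrow> int) \<Rightarrow> nat \<Rightarrow> nat \<Rightarrow> nat \<Rightarrow> nat" where
  "representation_count l1 l2 d1 d2 N =
     card {(m, n). 1 \<le> m \<and> 1 \<le> n \<and> m + n = N \<and>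
                   [int m = l1 d1] (mod int d1) \<and> [int n = l2 d2] (mod int d2)}"

definition weighted_discrepancy ::
  "(nat \<Rightarrow> int) \<Rightarrow> (nat \<Rightarrow> int) \<Rightarrow> (nat \<Rightarrow> complex) \<Rightarrow> (nat \<Rightarrow> complex) \<Rightarrow> real \<Rightarrow> nat \<Rightarrow> complex" where
  "weighted_discrepancy l1 l2 f1 f2 D N =
     (\<Sum>d1 | 1 \<le> d1 \<and> real d1 \<le> D. \<Sum>d2 | 1 \<le> d2 \<and> real d2 \<le> D.
        f1 d1 * f2 d2 *
        (of_nat (representation_count l1 l2 d1 d2 N)
         - of_nat N / of_nat (lcm d1 d2)
           * of_bool ([l1 d1 + l2 d2 = int N] (mod int (gcd d1 d2)))))"

end

theory Submission
  imports Defs "HOL-Real_Asymp.Real_Asymp" "HOL-Library.Discrete_Functions"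
begin

text \<open>
  Write \<open>a m\<close> for the sum of \<open>f\<^sub>1 d\<close> over \<open>d \<le> D\<close> with \<open>m \<equiv> l\<^sub>1 d (mod d)\<close>, and \<open>b\<close> for the analogue
  with \<open>f\<^sub>2, l\<^sub>2\<close>. Both are trigonometric polynomials whose frequencies \<open>r\<close> are the fractions with
  denominator at most \<open>D\<close>, with coefficients \<open>A r\<close>, \<open>B r\<close> of size \<open>O(log X / den r)\<close>, and the expected
  main term is exactly \<open>N \<Sum>\<^sub>r A r B r e(N r)\<close>. Split the frequencies at \<open>den r = Q = X\<^bsup>\<epsilon>/4\<^esup>\<close>.
  Fractions are well spaced, so sums of \<open>min(X, 1/\<parallel>\<alpha> - r\<parallel>) / den r\<close> over \<open>den r > Q\<close> are
  \<open>O((X/Q + D) log\<^sup>2 X)\<close> uniformly in \<open>\<alpha>\<close>. This bounds the exponential sum of the high-frequency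
  part of \<open>b\<close> uniformly, so by Parseval and the second moment hypothesis on \<open>a\<close> its convolution with \<open>a\<close>
  is small in mean square over \<open>N\<close>; the high-frequency part of the main term is small in mean square
  for the same reason. The low frequencies of \<open>b\<close> reproduce the rest of the main term up to
  off-diagonal terms that are small for every \<open>N\<close>. The range \<open>m \<le> D\<close>, which the second moment
  does not cover, is negligible on average over \<open>N\<close>.
\<close>

section \<open>Exponential sums and spaced frequencies\<close>

definition unit_char :: "real \<Rightarrow> complex" where
  "unit_char x = cis (2 * pi * x)"

lemma norm_unit_char [simp]: "cmod (unit_char x) = 1"
  by (simp add: unit_char_def)

lemma unit_char_0 [simp]: "unit_char 0 = 1"
  by (simp add: unit_char_def)

lemma unit_char_add: "unit_char (x + y) = unit_char x * unit_char y"
  by (simp add: unit_char_def cis_mult algebra_simps)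

lemma unit_char_power: "unit_char (real n * x) = unit_char x ^ n"
  by (simp add: unit_char_def DeMoivre mult_ac)

lemma cnj_unit_char: "cnj (unit_char x) = unit_char (- x)"
  by (simp add: unit_char_def cis_cnj)

lemma unit_char_of_Ints:
  assumes "x \<in> \<int>"
  shows "unit_char x = 1"
proof -
  obtain k where "x = of_int k" using assms by (elim Ints_cases)
  then show ?thesis
    by (auto simp: unit_char_def cis_multiple_2pi)
qed

lemma unit_char_eq_1_iff: "unit_char x = 1 \<longleftrightarrow> x \<in> \<int>"
proof
  assume "unit_char x = 1"
  then have "cos (2 * pi * x) = 1"
    by (simp add: unit_char_def complex_eq_iff)
  then obtain n :: int where "2 * pi * x = of_int n * 2 * pi"
    by (auto simp: cos_one_2pi_int)
  then have "x = of_int n" by simp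
  then show "x \<in> \<int>" by simp
qed (rule unit_char_of_Ints)

definition int_dist :: "real \<Rightarrow> real" where
  "int_dist x = \<bar>x - of_int (round x)\<bar>"

lemma int_dist_nonneg [simp]: "0 \<le> int_dist x"
  by (simp add: int_dist_def)

lemma int_dist_le: "int_dist x \<le> \<bar>x - of_int k\<bar>"
  unfolding int_dist_def by (rule round_diff_minimal)

lemma int_dist_le_half: "int_dist x \<le> 1 / 2"
  unfolding int_dist_def using of_int_round_abs_le[of x] by (simp add: abs_minus_commute)

lemma int_dist_uminus [simp]: "int_dist (- x) = int_dist x"
proof -
  have "int_dist (- x) \<le> int_dist x" for x
    using int_dist_le[of "- x" "- round x"] by (simp add: int_dist_def)
  from this[of x] this[of "- x"] show ?thesis by simp
qed

lemma int_dist_commute: "int_dist (x - y) = int_dist (y - x)"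
  using int_dist_uminus[of "x - y"] by simp

lemma int_dist_pos:
  assumes "x \<notin> \<int>"
  shows "0 < int_dist x"
proof -
  have "x \<noteq> of_int (round x)" using assms by (metis Ints_of_int)
  then show ?thesis by (simp add: int_dist_def)
qed

lemma int_dist_ge_inverse:
  assumes "real q * x \<in> \<int>" and "x \<notin> \<int>"
  shows "1 / real q \<le> int_dist x"
proof (cases "q = 0")
  case False
  have "real q * (x - of_int (round x)) \<in> \<int>"
    using assms(1) by (simp add: right_diff_distrib)
  moreover have "x - of_int (round x) \<noteq> 0"
    using assms(2) by (metis Ints_of_int eq_iff_diff_eq_0)
  with False have "real q * (x - of_int (round x)) \<noteq> 0" by simp
  ultimately have "1 \<le> \<bar>real q * (x - of_int (round x))\<bar>"
    by (rule Ints_nonzero_abs_ge1)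
  then show ?thesis
    using False by (simp add: int_dist_def abs_mult divide_le_eq mult.commute)
qed simp

text \<open>A weak Jordan inequality, with half the sharp constant 2/pi. Up to pi/3 the function sin
  t - t/2 is increasing; beyond, sin y is at least 1/2, hence at least y/pi.\<close>

lemma sin_ge_over_pi:
  assumes "0 \<le> y" and "y \<le> pi / 2"
  shows "y / pi \<le> sin y"
proof (cases "y \<le> pi / 3")
  case True
  have "0 \<le> sin y - y / 2"
  proof -
    have "sin 0 - 0 / 2 \<le> sin y - y / 2"
    proof (rule DERIV_nonneg_imp_nondecreasing[where f = "\<lambda>t. sin t - t / 2"])
      fix t assume t: "0 \<le> t" "t \<le> y"
      have "cos (pi / 3) \<le> cos t"
        using t True pi_gt_zero by (intro cos_monotone_0_pi_le) auto
      then have "0 \<le> cos t - 1 / 2" by (simp add: cos_60)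
      moreover have "((\<lambda>t. sin t - t / 2) has_real_derivative (cos t - 1 / 2)) (at t)"
        by (auto intro!: derivative_eq_intros)
      ultimately show "\<exists>z. ((\<lambda>t. sin t - t / 2) has_real_derivative z) (at t) \<and> 0 \<le> z"
        by blast
    qed (use assms in simp)
    then show ?thesis by simp
  qed
  moreover have "y / pi \<le> y / 2"
    using assms(1) pi_ge_two by (intro divide_left_mono) auto
  ultimately show ?thesis by linarith
next
  case False
  have "sin (pi / 6) \<le> sin y"
    using False assms pi_gt_zero by (intro sin_monotone_2pi_le) auto
  moreover have "y / pi \<le> 1 / 2" using assms pi_gt_zero by (simp add: field_simps)
  ultimately show ?thesis unfolding sin_30 by linarith
qed

text \<open>With t the signed offset of x from its nearest integer, the chord |e(t) - 1| has length
  2 |sin(pi t)|, and |sin(pi t)| >= |t| for |t| <= 1/2.\<close>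

lemma norm_unit_char_diff_1: "2 * int_dist x \<le> cmod (unit_char x - 1)"
proof -
  define t where "t = x - of_int (round x)"
  have "unit_char x = unit_char t * unit_char (of_int (round x))"
    by (simp add: t_def flip: unit_char_add)
  then have ex: "unit_char x = unit_char t" by (simp add: unit_char_of_Ints)
  have "(cmod (unit_char t - 1))\<^sup>2 = (cos (2 * pi * t) - 1)\<^sup>2 + (sin (2 * pi * t))\<^sup>2"
    by (simp add: unit_char_def cmod_power2)
  also have "\<dots> = 2 - 2 * cos (2 * (pi * t))"
    using sin_cos_squared_add[of "2 * pi * t"] by (simp add: power2_eq_square algebra_simps)
  also have "\<dots> = (2 * \<bar>sin (pi * t)\<bar>)\<^sup>2"
    by (simp add: cos_double_sin power_mult_distrib)
  finally have "cmod (unit_char t - 1) = 2 * \<bar>sin (pi * t)\<bar>"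
    by (rule power2_eq_imp_eq) auto
  moreover have "\<bar>t\<bar> \<le> \<bar>sin (pi * t)\<bar>"
  proof -
    have t: "\<bar>t\<bar> \<le> 1 / 2" using int_dist_le_half[of x] by (simp add: int_dist_def t_def)
    have "\<bar>t\<bar> = pi * \<bar>t\<bar> / pi" by simp
    also have "\<dots> \<le> sin (pi * \<bar>t\<bar>)"
      using t by (intro sin_ge_over_pi) auto
    also have "\<dots> \<le> \<bar>sin (pi * t)\<bar>" by (cases "t \<ge> 0") auto
    finally show ?thesis .
  qed
  ultimately show ?thesis by (simp add: ex int_dist_def flip: t_def)
qed

text \<open>A version of \<open>min Y (1 / int_dist x)\<close> that has the value \<open>Y\<close> at the integers,
  where \<open>1 / int_dist x = 0\<close>.\<close>

definition geom_bound :: "real \<Rightarrow> real \<Rightarrow> real" where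
  "geom_bound Y x = Y / max 1 (Y * int_dist x)"

lemma geom_bound_uminus [simp]: "geom_bound Y (- x) = geom_bound Y x"
  by (simp add: geom_bound_def)

lemma geom_bound_nonneg: "0 \<le> Y \<Longrightarrow> 0 \<le> geom_bound Y x"
  by (simp add: geom_bound_def)

lemma geom_bound_le: "0 \<le> Y \<Longrightarrow> geom_bound Y x \<le> Y"
  unfolding geom_bound_def by (simp add: divide_le_eq mult_le_cancel_left1)

lemma geom_bound_le_inverse:
  assumes "0 \<le> Y" "0 < c" "c \<le> int_dist x"
  shows "geom_bound Y x \<le> 1 / c"
proof -
  have "Y * c \<le> Y * int_dist x" using assms by (intro mult_left_mono) auto
  then show ?thesis using assms
    unfolding geom_bound_def by (simp add: pos_divide_le_eq less_max_iff_disj le_max_iff_disj)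
      (simp add: pos_le_divide_eq le_max_iff_disj)
qed

lemma geom_bound_eq_inverse:
  assumes "0 < Y" "1 / Y \<le> int_dist x"
  shows "geom_bound Y x = 1 / int_dist x"
  using assms by (simp add: geom_bound_def max_def field_simps)

text \<open>The trivial bound serves when \<open>Y * int_dist x \<le> 1\<close>; otherwise x is not
  an integer and the telescoped geometric sum is at most 2 / |e(x) - 1|.\<close>

lemma norm_sum_unit_char_le:
  assumes "real (b - a) \<le> Y"
  shows "cmod (\<Sum>n = a..<b. unit_char (real n * x)) \<le> geom_bound Y x"
proof -
  have Y: "0 \<le> Y" using assms by linarith
  have triv: "cmod (\<Sum>n = a..<b. unit_char (real n * x)) \<le> Y"
    using sum_norm_le[of "{a..<b}" "\<lambda>n. unit_char (real n * x)" "\<lambda>_. 1"] assms by simp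
  show ?thesis
  proof (cases "Y * int_dist x \<le> 1")
    case True
    then show ?thesis using triv by (simp add: geom_bound_def max_def)
  next
    case False
    then have Ypos: "Y > 0" "int_dist x > 0" using Y
      by (auto intro!: neq_le_trans)
    have ne: "unit_char x \<noteq> 1"
      using norm_unit_char_diff_1[of x] Ypos by auto
    have "cmod (\<Sum>n = a..<b. unit_char (real n * x)) \<le> 1 / int_dist x"
    proof (cases "a \<le> b")
      case True
      have "(unit_char x - 1) * (\<Sum>n = a..<b. unit_char (real n * x)) = unit_char x ^ b - unit_char x ^ a"
        using True unfolding unit_char_power
        by (simp add: sum_distrib_left left_diff_distrib
            flip: sum_Suc_diff'[of a b "\<lambda>n. unit_char x ^ n"])
      then have "cmod (unit_char x - 1) * cmod (\<Sum>n = a..<b. unit_char (real n * x))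
          = cmod (unit_char x ^ b - unit_char x ^ a)"
        by (metis norm_mult)
      also have "\<dots> \<le> 2"
        using norm_triangle_ineq4[of "unit_char x ^ b" "unit_char x ^ a"] by (simp add: norm_power)
      finally have "cmod (unit_char x - 1) * cmod (\<Sum>n = a..<b. unit_char (real n * x)) \<le> 2" .
      moreover have "2 * int_dist x * cmod (\<Sum>n = a..<b. unit_char (real n * x))
          \<le> cmod (unit_char x - 1) * cmod (\<Sum>n = a..<b. unit_char (real n * x))"
        by (intro mult_right_mono norm_unit_char_diff_1) auto
      ultimately show ?thesis using Ypos by (simp add: field_simps)
    qed simp
    then show ?thesis using False Ypos by (simp add: geom_bound_def max_def)
  qed
qed

section \<open>Harmonic sums and sums over well spaced points\<close>

lemma harmonic_sum_le:
  assumes "1 \<le> n"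
  shows "(\<Sum>k = 1..n. 1 / real k) \<le> 1 + ln (real n)"
  using assms
proof (induction n rule: dec_induct)
  case (step n)
  have "ln (real n / real (Suc n)) \<le> real n / real (Suc n) - 1"
    using step by (intro ln_le_minus_one) auto
  also have "\<dots> = - (1 / real (Suc n))" by (simp add: field_simps)
  finally have "1 / real (Suc n) \<le> ln (real (Suc n)) - ln (real n)"
    using step by (simp add: ln_div)
  then show ?case using step by simp
qed simp

lemma harmonic_sum_real_le:
  assumes "1 \<le> D"
  shows "(\<Sum>d | 1 \<le> d \<and> real d \<le> D. 1 / real d) \<le> 1 + ln D"
proof -
  define n where "n = nat \<lfloor>D\<rfloor>"
  have "{d. 1 \<le> d \<and> real d \<le> D} = {1..n}"
    using assms by (auto simp: n_def le_nat_floor le_floor_iff nat_le_iff le_nat_iff)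
  moreover have n: "1 \<le> n" "real n \<le> D"
    using assms by (auto simp: n_def le_nat_iff)
  moreover have "ln (real n) \<le> ln D" using n by (intro ln_mono) auto
  ultimately show ?thesis using harmonic_sum_le[of n] by (metis add_left_mono order_trans)
qed

lemma finite_nat_le_real: "finite {d. 1 \<le> d \<and> real d \<le> D}"
  by (rule finite_subset[of _ "{..nat \<lfloor>D\<rfloor>}"]) (auto simp: le_nat_floor)

declare finite_nat_le_real[simp] finite_nat_le_real[unfolded One_nat_def, simp]

text \<open>Distinct points of a \<open>\<delta>\<close>-spaced set fall into distinct cells of a mesh of width
  \<open>\<delta>\<close> centred at \<open>\<alpha>\<close>.\<close>

lemma sum_geom_bound_spaced:
  assumes fin: "finite S" and \<delta>: "0 < \<delta>" "\<delta> \<le> 1" and Y: "0 \<le> Y"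
    and spaced: "\<And>s t. s \<in> S \<Longrightarrow> t \<in> S \<Longrightarrow> s \<noteq> t \<Longrightarrow> \<delta> \<le> int_dist (s - t)"
  shows "(\<Sum>s\<in>S. geom_bound Y (\<alpha> - s)) \<le> 2 * Y + 2 / \<delta> * (1 + ln (1 / \<delta>))"
proof -
  \<comment> \<open>\<open>\<sigma> s\<close> represents \<alpha> - s modulo 1 in [-1/2, 1/2], and
    \<open>j s\<close> is the index i of its cell, which runs from i\<delta> to (i+1)\<delta>.
    \<open>h i\<close> bounds \<open>geom_bound\<close> on cell i: cells 0 and -1 touch 0 and get
    the trivial Y, all others the inverse of their distance from 0.\<close>
  define \<sigma> where "\<sigma> s = (\<alpha> - s) - of_int (round (\<alpha> - s))" for s
  define j where "j s = \<lfloor>\<sigma> s / \<delta>\<rfloor>" for s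
  define J where "J = \<lfloor>1 / (2 * \<delta>)\<rfloor>"
  define h where "h i = (if i = 0 \<or> i = - 1 then Y
      else if i > 0 then 1 / (of_int i * \<delta>) else 1 / (of_int (- i - 1) * \<delta>))" for i :: int
  have dist: "int_dist (\<alpha> - s) = \<bar>\<sigma> s\<bar>" for s by (simp add: int_dist_def \<sigma>_def)
  have J0: "0 \<le> J" using \<delta> by (simp add: J_def)
  have h0: "0 \<le> h i" for i using \<delta> Y by (auto simp: h_def)
  have inj: "inj_on j S"
  proof (rule inj_onI, rule ccontr)
    fix s t assume st: "s \<in> S" "t \<in> S" "j s = j t" "s \<noteq> t"
    have "\<bar>\<sigma> s / \<delta> - \<sigma> t / \<delta>\<bar> < 1"
      using st(3) unfolding j_def by linarith
    then have "\<bar>\<sigma> s - \<sigma> t\<bar> < \<delta>"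
      using \<delta> by (simp add: abs_divide flip: diff_divide_distrib)
    \<comment> \<open>Up to sign, \<open>\<sigma> s - \<sigma> t\<close> differs from s - t by an
      integer.\<close>
    moreover have "int_dist (s - t) \<le> \<bar>s - t - of_int (round (\<alpha> - t) - round (\<alpha> - s))\<bar>"
      by (rule int_dist_le)
    then have "int_dist (s - t) \<le> \<bar>\<sigma> s - \<sigma> t\<bar>"
      unfolding \<sigma>_def by simp
    ultimately show False using spaced[OF st(1,2,4)] by linarith
  qed
  have range: "j s \<in> {- J - 1..J}" for s
  proof -
    have "\<bar>\<sigma> s\<bar> \<le> 1 / 2" using int_dist_le_half[of "\<alpha> - s"] dist by simp
    then have "\<bar>\<sigma> s\<bar> / \<delta> \<le> 1 / 2 / \<delta>" using \<delta> by (intro divide_right_mono) auto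
    then have "\<bar>\<sigma> s / \<delta>\<bar> \<le> 1 / (2 * \<delta>)"
      using \<delta> by (simp add: abs_divide)
    then show ?thesis unfolding j_def J_def atLeastAtMost_iff by linarith
  qed
  have cell_le: "geom_bound Y (\<alpha> - s) \<le> h (j s)" for s
  proof -
    consider "j s = 0 \<or> j s = - 1" | "j s > 0" | "j s < - 1" by linarith
    then show ?thesis
    proof cases
      case 1
      then show ?thesis using geom_bound_le[OF Y] by (auto simp: h_def)
    next
      case 2
      have "of_int (j s) \<le> \<sigma> s / \<delta>" by (simp add: j_def)
      then have "of_int (j s) * \<delta> \<le> int_dist (\<alpha> - s)"
        using \<delta> 2 by (simp add: field_simps dist)
      then show ?thesis using 2 \<delta> geom_bound_le_inverse[OF Y, of "of_int (j s) * \<delta>" "\<alpha> - s"]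
        by (simp add: h_def)
    next
      case 3
      have "\<sigma> s / \<delta> < of_int (j s) + 1" unfolding j_def by linarith
      then have "\<sigma> s < (of_int (j s) + 1) * \<delta>" using \<delta> by (simp add: field_simps)
      then have "of_int (- j s - 1) * \<delta> \<le> int_dist (\<alpha> - s)"
        unfolding dist by (simp add: algebra_simps)
      moreover have "0 < (of_int (- j s - 1) :: real) * \<delta>"
        using 3 \<delta> by (intro mult_pos_pos) auto
      ultimately have "geom_bound Y (\<alpha> - s) \<le> 1 / (of_int (- j s - 1) * \<delta>)"
        using geom_bound_le_inverse[OF Y] by blast
      then show ?thesis using 3 by (simp add: h_def)
    qed
  qed
  have H: "(\<Sum>i\<in>{1..J}. 1 / (of_int i * \<delta>)) \<le> 1 / \<delta> * (1 + ln (1 / \<delta>))"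
  proof (cases "J \<ge> 1")
    case True
    have "(\<Sum>i\<in>{1..J}. 1 / (of_int i * \<delta>)) = 1 / \<delta> * (\<Sum>i\<in>{1..J}. 1 / of_int i)"
      by (simp add: sum_distrib_left mult.commute)
    also have "(\<Sum>i\<in>{1..J}. 1 / of_int i) = (\<Sum>k = 1..nat J. 1 / real k)"
      by (rule sum.reindex_bij_witness[of _ int nat]) auto
    also have "\<dots> \<le> 1 + ln (real (nat J))" using True by (intro harmonic_sum_le) auto
    also have "ln (real (nat J)) \<le> ln (1 / \<delta>)"
    proof -
      have "of_int J \<le> 1 / (2 * \<delta>)" by (simp add: J_def)
      also have "\<dots> \<le> 1 / \<delta>" using \<delta> by (simp add: field_simps)
      finally show ?thesis using True \<delta> by simp
    qed
    finally show ?thesis using \<delta> by (simp add: divide_right_mono)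
  next
    case False
    moreover have "0 \<le> 1 / \<delta> * (1 + ln (1 / \<delta>))"
      using \<delta> by (intro mult_nonneg_nonneg add_nonneg_nonneg ln_ge_zero) auto
    ultimately show ?thesis by simp
  qed
  have "(\<Sum>s\<in>S. geom_bound Y (\<alpha> - s)) \<le> (\<Sum>s\<in>S. h (j s))"
    by (intro sum_mono cell_le)
  also have "\<dots> = (\<Sum>i\<in>j ` S. h i)" using inj by (simp add: sum.reindex)
  also have "\<dots> \<le> (\<Sum>i\<in>{- J - 1..J}. h i)"
    using range h0 by (intro sum_mono2) auto
  also have "{- J - 1..J} = {- 1, 0} \<union> {1..J} \<union> {- J - 1..- 2}" using J0 by auto
  also have "(\<Sum>i\<in>{- 1, 0} \<union> {1..J} \<union> {- J - 1..- 2}. h i)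
      = 2 * Y + (\<Sum>i\<in>{1..J}. h i) + (\<Sum>i\<in>{- J - 1..- 2}. h i)"
    by (subst sum.union_disjoint; (subst sum.union_disjoint)?) (auto simp: h_def)
  also have "(\<Sum>i\<in>{1..J}. h i) = (\<Sum>i\<in>{1..J}. 1 / (of_int i * \<delta>))"
    by (rule sum.cong) (auto simp: h_def)
  \<comment> \<open>The reflection i -> -i-1 exchanges the cells on the two sides of 0, giving a
    second copy of the same harmonic sum.\<close>
  also have "(\<Sum>i\<in>{- J - 1..- 2}. h i) = (\<Sum>i\<in>{1..J}. 1 / (of_int i * \<delta>))"
    by (rule sum.reindex_bij_witness[of _ "\<lambda>i. - i - 1" "\<lambda>i. - i - 1"]) (auto simp: h_def)
  finally have "(\<Sum>s\<in>S. geom_bound Y (\<alpha> - s)) \<le> 2 * Y + 2 * (1 / \<delta> * (1 + ln (1 / \<delta>)))"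
    using H by linarith
  then show ?thesis by simp
qed

section \<open>Fractions with bounded denominator\<close>

text \<open>The d-torsion of the circle R/Z, each class taken at its representative in [0,
  1).\<close>

definition torsion :: "nat \<Rightarrow> real set" where
  "torsion d = {r. 0 \<le> r \<and> r < 1 \<and> real d * r \<in> \<int>}"

lemma torsion_eq_image:
  assumes "1 \<le> d"
  shows "torsion d = (\<lambda>k. real k / real d) ` {..<d}"
proof
  show "torsion d \<subseteq> (\<lambda>k. real k / real d) ` {..<d}"
  proof
    fix r assume r: "r \<in> torsion d"
    then obtain k where k: "real d * r = of_int k"
      by (auto simp: torsion_def elim: Ints_cases)
    have "0 \<le> (of_int k :: real)"
      using r by (simp add: torsion_def flip: k)
    moreover have "real d * r < real d * 1"
      using r assms unfolding torsion_def by (intro mult_strict_left_mono) auto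
    then have "(of_int k :: real) < of_int (int d)" by (simp add: k)
    ultimately have "0 \<le> k" "k < int d" by (simp_all only: of_int_less_iff of_int_0_le_iff)
    moreover from this have "r = real (nat k) / real d"
      using k assms by (simp add: field_simps)
    ultimately show "r \<in> (\<lambda>k. real k / real d) ` {..<d}"
      by (intro image_eqI[of _ _ "nat k"]) auto
  qed
qed (use assms in \<open>auto simp: torsion_def\<close>)

lemma inj_on_divide_real: "1 \<le> d \<Longrightarrow> inj_on (\<lambda>k. real k / real d) A"
  by (auto simp: inj_on_def)

lemma finite_torsion: "1 \<le> d \<Longrightarrow> finite (torsion d)"
  by (simp add: torsion_eq_image)

lemma card_torsion: "1 \<le> d \<Longrightarrow> card (torsion d) = d"
  by (simp add: torsion_eq_image card_image inj_on_divide_real)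

lemma of_int_divide_in_Ints_iff:
  assumes "1 \<le> d"
  shows "(of_int h / real d \<in> \<int>) \<longleftrightarrow> int d dvd h"
proof
  assume "of_int h / real d \<in> \<int>"
  then obtain k where "of_int h / real d = of_int k" by (elim Ints_cases)
  then have "(of_int h :: real) = of_int (int d * k)" using assms by (simp add: field_simps)
  then have "h = int d * k" by (simp only: of_int_eq_iff)
  then show "int d dvd h" by simp
qed (use assms in \<open>auto elim!: dvdE\<close>)

text \<open>Orthogonality of characters modulo d: the terms are the powers of a d-th root of unity,
  which is 1 exactly when d divides h.\<close>

lemma sum_torsion_unit_char:
  assumes "1 \<le> d"
  shows "(\<Sum>r\<in>torsion d. unit_char (r * of_int h)) = (if int d dvd h then of_nat d else 0)"
proof -
  define z where "z = unit_char (of_int h / real d)"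
  have "(\<Sum>r\<in>torsion d. unit_char (r * of_int h)) = (\<Sum>k<d. unit_char (real k * (of_int h / real d)))"
    using assms by (simp add: torsion_eq_image sum.reindex inj_on_divide_real)
  also have "\<dots> = (\<Sum>k<d. z ^ k)"
    unfolding z_def unit_char_power ..
  also have "\<dots> = (if int d dvd h then of_nat d else 0)"
  proof (cases "int d dvd h")
    case True
    then have "z = 1"
      unfolding z_def unit_char_eq_1_iff of_int_divide_in_Ints_iff[OF assms] .
    then show ?thesis using True by simp
  next
    case False
    then have "z \<noteq> 1"
      unfolding z_def unit_char_eq_1_iff of_int_divide_in_Ints_iff[OF assms] .
    moreover have "z ^ d = unit_char (of_int h)"
      using assms by (simp add: z_def flip: unit_char_power)
    then have "z ^ d = 1" by (simp add: unit_char_of_Ints)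
    ultimately show ?thesis using False by (simp add: geometric_sum)
  qed
  finally show ?thesis .
qed

definition fractions :: "real \<Rightarrow> real set" where
  "fractions D = (\<Union>d\<in>{d. 1 \<le> d \<and> real d \<le> D}. torsion d)"

text \<open>For rational r this is the denominator in lowest terms. Reading it off from r keeps
  frequencies as plain reals, so that equal fractions coming from different moduli coincide.\<close>

definition den :: "real \<Rightarrow> nat" where
  "den r = (LEAST d. 1 \<le> d \<and> real d * r \<in> \<int>)"

lemma finite_fractions [simp]: "finite (fractions D)"
  unfolding fractions_def by (intro finite_UN_I finite_nat_le_real) (auto intro: finite_torsion)

lemma fractions_bounds: "r \<in> fractions D \<Longrightarrow> 0 \<le> r \<and> r < 1"
  by (auto simp: fractions_def torsion_def)

lemma fractions_torsion:
  assumes "1 \<le> d" "real d \<le> D"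
  shows "{r \<in> fractions D. real d * r \<in> \<int>} = torsion d"
  using assms by (auto simp: fractions_def torsion_def)

lemma den_props:
  assumes "r \<in> fractions D"
  shows "1 \<le> den r" "real (den r) * r \<in> \<int>" "real (den r) \<le> D"
proof -
  obtain d where d: "1 \<le> d" "real d \<le> D" "real d * r \<in> \<int>"
    using assms by (auto simp: fractions_def torsion_def)
  have "1 \<le> den r \<and> real (den r) * r \<in> \<int>"
    unfolding den_def by (rule LeastI[of _ d]) (use d in auto)
  moreover have "den r \<le> d" unfolding den_def by (rule Least_le) (use d in auto)
  then have "real (den r) \<le> real d" by simp
  ultimately show "1 \<le> den r" "real (den r) * r \<in> \<int>" "real (den r) \<le> D"
    using d by auto
qed

text \<open>Otherwise \<open>d mod den r\<close> would be a smaller positive multiplier taking r to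
  an integer, against minimality.\<close>

lemma den_dvd:
  assumes "r \<in> fractions D" "real d * r \<in> \<int>"
  shows "den r dvd d"
proof (rule ccontr)
  assume "\<not> den r dvd d"
  then have pos: "1 \<le> d mod den r" by (simp add: dvd_eq_mod_eq_0 Suc_leI)
  have "real d = real (d div den r) * real (den r) + real (d mod den r)"
    by (metis div_mult_mod_eq of_nat_add of_nat_mult)
  then have "real (d mod den r) * r = real d * r - real (d div den r) * (real (den r) * r)"
    by (simp add: algebra_simps)
  also have "\<dots> \<in> \<int>"
    using assms(2) den_props(2)[OF assms(1)] by auto
  finally have "den r \<le> d mod den r"
    using pos unfolding den_def[of r] by (intro Least_le) (simp flip: den_def)
  moreover have "d mod den r < den r"
    using den_props(1)[OF assms(1)] by (intro mod_less_divisor) auto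
  ultimately show False by simp
qed

lemma fractions_diff_not_Ints:
  assumes "r \<in> fractions D" "s \<in> fractions E" "r \<noteq> s"
  shows "r - s \<notin> \<int>"
proof
  assume "r - s \<in> \<int>"
  then have "1 \<le> \<bar>r - s\<bar>" using assms by (intro Ints_nonzero_abs_ge1) auto
  then show False using fractions_bounds[OF assms(1)] fractions_bounds[OF assms(2)] by linarith
qed

text \<open>Multiplied by \<open>den r * den s\<close>, the difference becomes an integer; it is not
  an integer itself, since both points lie in [0, 1) and differ.\<close>

lemma fractions_spacing:
  assumes "r \<in> fractions D" "s \<in> fractions E" "r \<noteq> s"
  shows "1 / (real (den r) * real (den s)) \<le> int_dist (r - s)"
proof -
  have "real (den r * den s) * (r - s)
      = real (den s) * (real (den r) * r) - real (den r) * (real (den s) * s)"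
    by (simp add: algebra_simps)
  also have "\<dots> \<in> \<int>"
    using den_props(2)[OF assms(1)] den_props(2)[OF assms(2)] by auto
  finally show ?thesis
    using int_dist_ge_inverse[of "den r * den s" "r - s"] fractions_diff_not_Ints[OF assms] by simp
qed

text \<open>Fractions are grouped by denominator; those of denominator q lie in
  \<open>torsion q\<close>, so there are at most q of them.\<close>

lemma sum_fractions_den_le:
  assumes S: "S \<subseteq> fractions D" and T: "finite T" "den ` S \<subseteq> T" and g: "\<And>q. q \<in> T \<Longrightarrow> 0 \<le> g q"
  shows "(\<Sum>r\<in>S. g (den r)) \<le> (\<Sum>q\<in>T. real q * g q)"
proof -
  have fin: "finite S" using S by (rule finite_subset) simp
  have "(\<Sum>r\<in>S. g (den r)) = (\<Sum>q\<in>T. \<Sum>r\<in>{r\<in>S. den r = q}. g (den r))"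
    using fin T by (rule sum.group[symmetric])
  also have "\<dots> = (\<Sum>q\<in>T. real (card {r\<in>S. den r = q}) * g q)"
    by simp
  also have "\<dots> \<le> (\<Sum>q\<in>T. real q * g q)"
  proof (intro sum_mono mult_right_mono g)
    fix q
    show "real (card {r\<in>S. den r = q}) \<le> real q"
    proof (cases "{r\<in>S. den r = q} = {}")
      case False
      then have q: "1 \<le> q" using S den_props(1) by blast
      have "{r\<in>S. den r = q} \<subseteq> torsion q"
        using S den_props(2) fractions_bounds by (fastforce simp: torsion_def)
      then have "card {r\<in>S. den r = q} \<le> card (torsion q)"
        by (rule card_mono[OF finite_torsion[OF q]])
      then show ?thesis using q by (simp add: card_torsion)
    qed (simp only: card.empty of_nat_0 of_nat_0_le_iff)
  qed
  finally show ?thesis .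
qed

lemma sum_fractions_inverse_den_le:
  assumes "1 \<le> Q"
  shows "(\<Sum>r | r \<in> fractions D \<and> real (den r) \<le> Q. 1 / real (den r)) \<le> Q"
proof -
  have "(\<Sum>r | r \<in> fractions D \<and> real (den r) \<le> Q. 1 / real (den r))
      \<le> (\<Sum>q | 1 \<le> q \<and> real q \<le> Q. real q * (1 / real q))"
    using den_props(1) by (intro sum_fractions_den_le[where D = D] finite_nat_le_real) auto
  also have "\<dots> = (\<Sum>q | 1 \<le> q \<and> real q \<le> Q. 1)"
    by (rule sum.cong) auto
  also have "\<dots> = real (card {q. 1 \<le> q \<and> real q \<le> Q})" by simp
  also have "\<dots> \<le> real (card {1..nat \<lfloor>Q\<rfloor>})"
    by (intro of_nat_mono card_mono) (auto simp: le_nat_floor)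
  also have "\<dots> \<le> Q" using assms by simp
  finally show ?thesis .
qed

lemma sum_fractions_inverse_den_sq_le:
  assumes "1 \<le> D"
  shows "(\<Sum>r\<in>fractions D. 1 / (real (den r))\<^sup>2) \<le> 1 + ln D"
proof -
  have "(\<Sum>r\<in>fractions D. 1 / (real (den r))\<^sup>2)
      \<le> (\<Sum>q | 1 \<le> q \<and> real q \<le> D. real q * (1 / (real q)\<^sup>2))"
    using den_props by (intro sum_fractions_den_le[where D = D] finite_nat_le_real) auto
  also have "\<dots> = (\<Sum>q | 1 \<le> q \<and> real q \<le> D. 1 / real q)"
    by (rule sum.cong) (auto simp: power2_eq_square)
  also have "\<dots> \<le> 1 + ln D" by (rule harmonic_sum_real_le[OF assms])
  finally show ?thesis .
qed

text \<open>Denominators below 2^(i+1) force spacing 4^-(i+1), so the bound for spaced points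
  applies. The constant 24 is 2 times 4 times the 3 that comes from the logarithm of
  1/\<delta>.\<close>

lemma sum_geom_bound_fractions_dyadic:
  assumes X: "1 \<le> X" "2 ^ i \<le> X" and Y: "0 \<le> Y"
    and S: "S \<subseteq> fractions D" "\<And>s. s \<in> S \<Longrightarrow> den s < 2 ^ Suc i"
  shows "(\<Sum>s\<in>S. geom_bound Y (\<alpha> - s)) \<le> 2 * Y + 24 * 4 ^ i * (1 + ln X)"
proof -
  define \<delta> :: real where "\<delta> = 1 / 4 ^ Suc i"
  have fin: "finite S" using S(1) by (rule finite_subset) simp
  have "(\<Sum>s\<in>S. geom_bound Y (\<alpha> - s)) \<le> 2 * Y + 2 / \<delta> * (1 + ln (1 / \<delta>))"
  proof (rule sum_geom_bound_spaced[OF fin _ _ Y])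
    fix s t assume st: "s \<in> S" "t \<in> S" "s \<noteq> t"
    have "real (den s) \<le> 2 ^ Suc i" if "s \<in> S" for s
      using S(2)[OF that] by (metis less_imp_le of_nat_le_iff of_nat_numeral of_nat_power)
    then have "real (den s) * real (den t) \<le> 2 ^ Suc i * 2 ^ Suc i"
      using st by (intro mult_mono) auto
    also have "\<dots> = 4 ^ Suc i" by (simp flip: power_mult_distrib)
    finally have "\<delta> \<le> 1 / (real (den s) * real (den t))"
      using st S(1) den_props(1) unfolding \<delta>_def
      by (intro divide_left_mono mult_pos_pos) (auto simp: Suc_le_eq subset_iff)
    also have "\<dots> \<le> int_dist (s - t)" using st S(1) by (intro fractions_spacing) auto
    finally show "\<delta> \<le> int_dist (s - t)" .
  qed (auto simp: \<delta>_def divide_le_eq simp del: power_Suc)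
  also have "1 + ln (1 / \<delta>) \<le> 3 * (1 + ln X)"
  proof -
    have "1 / \<delta> = (2 * 2 ^ i)\<^sup>2" by (simp add: \<delta>_def power2_eq_square flip: power_mult_distrib)
    then have "ln (1 / \<delta>) = 2 * (ln 2 + ln (2 ^ i))"
      by (simp only: ln_realpow ln_mult) (simp add: ln_mult ln_realpow)
    moreover have "ln (2 ^ i) \<le> ln X" using X by (intro ln_mono) auto
    moreover have "0 \<le> ln X" using X by simp
    ultimately show ?thesis using ln_2_less_1 by argo
  qed
  then have "2 / \<delta> * (1 + ln (1 / \<delta>)) \<le> 2 / \<delta> * (3 * (1 + ln X))"
    by (intro mult_left_mono) (auto simp: \<delta>_def)
  finally show ?thesis by (simp add: \<delta>_def algebra_simps)
qed

text \<open>Dyadic decomposition in the denominator. On a block of denominators near 2^i, dividing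
  the dyadic bound by 2^i leaves O(Y/2^i + 2^i (1 + ln X)); 2^i lies between Q/2 and D, and there
  are O(1 + ln X) blocks.\<close>

lemma sum_geom_bound_fractions_le:
  assumes Q: "1 \<le> Q" and D: "D \<le> X" "1 \<le> D" and Y: "0 \<le> Y"
  shows "(\<Sum>s | s \<in> fractions D \<and> Q \<le> real (den s). geom_bound Y (\<alpha> - s) / real (den s))
    \<le> 56 * (1 + ln X)\<^sup>2 * (Y / Q + D)"
proof -
  define L where "L = 1 + ln X"
  define S where "S = {s. s \<in> fractions D \<and> Q \<le> real (den s)}"
  define T where "T = {..nat \<lfloor>2 * ln X\<rfloor>}"
  have L: "1 \<le> L" using D by (simp add: L_def)
  have fin: "finite S" by (simp add: S_def)
  have pow: "2 ^ floor_log (den s) \<le> den s" "den s < 2 ^ Suc (floor_log (den s))"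
      "2 ^ floor_log (den s) \<le> D" "Q < 2 ^ Suc (floor_log (den s))" if "s \<in> S" for s
  proof -
    have d: "1 \<le> den s" "real (den s) \<le> D" "Q \<le> real (den s)"
      using that den_props by (auto simp: S_def)
    show *: "2 ^ floor_log (den s) \<le> den s" using d by (intro floor_log_exp2_le) auto
    show **: "den s < 2 ^ Suc (floor_log (den s))"
      using floor_log_exp2_gt[of "den s"] d by simp
    show "2 ^ floor_log (den s) \<le> D" using * d(2)
      by (metis of_nat_le_iff of_nat_numeral of_nat_power order_trans)
    show "Q < 2 ^ Suc (floor_log (den s))" using ** d(3)
      by (metis of_nat_less_iff of_nat_numeral of_nat_power order_le_less_trans)
  qed
  have T: "(\<lambda>s. floor_log (den s)) ` S \<subseteq> T"
  proof safe
    fix s assume s: "s \<in> S"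
    have "(2::real) ^ floor_log (den s) \<le> X" using pow(3)[OF s] D by simp
    then have "ln ((2::real) ^ floor_log (den s)) \<le> ln X" using D by (intro ln_mono) auto
    then have "real (floor_log (den s)) * ln 2 \<le> ln X" by (simp add: ln_realpow)
    \<comment> \<open>This uses ln 2 >= 1/2, which follows from ln (1/2) <= -1/2.\<close>
    moreover have "real (floor_log (den s)) * (1 / 2) \<le> real (floor_log (den s)) * ln 2"
      using ln_le_minus_one[of "1 / 2"] by (intro mult_left_mono) (auto simp: ln_div)
    ultimately have "real (floor_log (den s)) \<le> 2 * ln X" by simp
    then show "floor_log (den s) \<in> T" by (simp add: T_def le_nat_floor)
  qed
  have "(\<Sum>s\<in>S. geom_bound Y (\<alpha> - s) / real (den s))
      = (\<Sum>i\<in>T. \<Sum>s\<in>{s\<in>S. floor_log (den s) = i}. geom_bound Y (\<alpha> - s) / real (den s))"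
    using fin T by (intro sum.group[symmetric]) (auto simp: T_def)
  also have "\<dots> \<le> (\<Sum>i\<in>T. 4 * Y / Q + 24 * D * L)"
  proof (rule sum_mono)
    fix i
    define Si where "Si = {s\<in>S. floor_log (den s) = i}"
    have "(\<Sum>s\<in>Si. geom_bound Y (\<alpha> - s) / real (den s)) \<le> 4 * Y / Q + 24 * D * L"
    proof (cases "Si = {}")
      case True
      then show ?thesis using Y Q D L by simp
    next
      case False
      \<comment> \<open>A nonempty block contains a denominator that is at least Q, hence Q <
        2^(i+1).\<close>
      then have i: "2 ^ i \<le> D" "Q < 2 * 2 ^ i" using pow(3,4) by (auto simp: Si_def)
      have "(\<Sum>s\<in>Si. geom_bound Y (\<alpha> - s) / real (den s)) \<le> (\<Sum>s\<in>Si. geom_bound Y (\<alpha> - s) / 2 ^ i)"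
      proof (intro sum_mono divide_left_mono geom_bound_nonneg Y)
        fix s assume "s \<in> Si"
        then have "2 ^ i \<le> den s" using pow(1)[of s] by (auto simp: Si_def)
        then show "2 ^ i \<le> real (den s)" by (metis of_nat_le_iff of_nat_numeral of_nat_power)
        then have "0 < real (den s)" by (rule less_le_trans[rotated]) simp
        then show "0 < real (den s) * 2 ^ i" by simp
      qed
      also have "\<dots> = (\<Sum>s\<in>Si. geom_bound Y (\<alpha> - s)) / 2 ^ i"
        by (simp add: sum_divide_distrib)
      also have "\<dots> \<le> (2 * Y + 24 * 4 ^ i * L) / 2 ^ i"
        unfolding L_def using D i pow(2) Y
        by (intro divide_right_mono sum_geom_bound_fractions_dyadic[where D = D])
          (auto simp: Si_def S_def)
      also have "\<dots> = 2 * Y / 2 ^ i + 24 * (4 ^ i / 2 ^ i) * L"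
        by (simp add: add_divide_distrib)
      also have "(4::real) ^ i / 2 ^ i = 2 ^ i" by (simp flip: power_divide)
      also have "2 * Y / 2 ^ i \<le> 4 * Y / Q"
      proof -
        have "2 * Y * Q \<le> 2 * Y * (2 * 2 ^ i)" using Y i by (intro mult_left_mono) auto
        then show ?thesis using Q by (simp add: field_simps)
      qed
      also have "24 * 2 ^ i * L \<le> 24 * D * L" using i L by (intro mult_right_mono) auto
      finally show ?thesis by simp
    qed
    then show "(\<Sum>s\<in>{s\<in>S. floor_log (den s) = i}. geom_bound Y (\<alpha> - s) / real (den s))
        \<le> 4 * Y / Q + 24 * D * L" by (simp add: Si_def)
  qed
  also have "\<dots> = real (card T) * (4 * Y / Q + 24 * D * L)" by simp
  also have "\<dots> \<le> (2 * L) * (28 * L * (Y / Q + D))"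
  proof (rule mult_mono)
    have "0 \<le> ln X" using D by simp
    then show "real (card T) \<le> 2 * L" unfolding T_def L_def by simp linarith
    have "4 * (Y / Q) \<le> 28 * L * (Y / Q)" using L Y Q by (intro mult_right_mono) auto
    moreover have "24 * D * L \<le> 28 * L * D" using L D by simp
    ultimately show "4 * Y / Q + 24 * D * L \<le> 28 * L * (Y / Q + D)"
      by (simp add: distrib_left)
  qed (use L Y Q D in auto)
  also have "\<dots> = 56 * L\<^sup>2 * (Y / Q + D)" by (simp add: power2_eq_square)
  finally show ?thesis by (simp add: S_def L_def)
qed

section \<open>Fourier expansion of sums over progressions\<close>

lemma sum_swap3:
  "(\<Sum>a\<in>A. \<Sum>b\<in>B. \<Sum>c\<in>C. g a b c) = (\<Sum>b\<in>B. \<Sum>c\<in>C. \<Sum>a\<in>A. g a b c)"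
proof -
  have "(\<Sum>a\<in>A. \<Sum>b\<in>B. \<Sum>c\<in>C. g a b c) = (\<Sum>b\<in>B. \<Sum>a\<in>A. \<Sum>c\<in>C. g a b c)"
    by (rule sum.swap)
  also have "\<dots> = (\<Sum>b\<in>B. \<Sum>c\<in>C. \<Sum>a\<in>A. g a b c)"
    by (intro sum.cong refl sum.swap)
  finally show ?thesis .
qed

text \<open>The coefficient at frequency r once each congruence indicator modulo d is expanded into
  characters from \<open>torsion d\<close>; every d <= D with dr an integer contributes.\<close>

definition freq_coeff :: "(nat \<Rightarrow> complex) \<Rightarrow> (nat \<Rightarrow> int) \<Rightarrow> real \<Rightarrow> real \<Rightarrow> complex" where
  "freq_coeff f l D r = (\<Sum>d | (1 \<le> d \<and> real d \<le> D) \<and> real d * r \<in> \<int>.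
      f d / of_nat d * unit_char (- (r * of_int (l d))))"

definition prog_sum :: "(nat \<Rightarrow> complex) \<Rightarrow> (nat \<Rightarrow> int) \<Rightarrow> real \<Rightarrow> nat \<Rightarrow> complex" where
  "prog_sum f l D m = (\<Sum>d | 1 \<le> d \<and> real d \<le> D \<and> [int m = l d] (mod int d). f d)"

text \<open>Only multiples d = \<open>den r * k\<close> contribute, so the triangle inequality
  leaves 1 / \<open>den r\<close> times a harmonic sum over k.\<close>

lemma norm_freq_coeff_le:
  assumes D: "1 \<le> D" and f: "\<And>n. 1 \<le> n \<Longrightarrow> cmod (f n) \<le> 1" and r: "r \<in> fractions D"
  shows "cmod (freq_coeff f l D r) \<le> (1 + ln D) / real (den r)"
proof -
  let ?A = "{d. (1 \<le> d \<and> real d \<le> D) \<and> real d * r \<in> \<int>}"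
  let ?B = "{d. 1 \<le> d \<and> real d \<le> D}"
  have den: "1 \<le> den r" by (rule den_props(1)[OF r])
  have "cmod (freq_coeff f l D r) \<le> (\<Sum>d\<in>?A. 1 / real d)"
    unfolding freq_coeff_def
  proof (rule sum_norm_le)
    fix d assume "d \<in> ?A"
    then show "cmod (f d / of_nat d * unit_char (- (r * of_int (l d)))) \<le> 1 / real d"
      using f[of d] by (simp add: norm_mult norm_divide divide_right_mono)
  qed
  also have "\<dots> \<le> (\<Sum>d\<in>(\<lambda>k. den r * k) ` ?B. 1 / real d)"
  proof (rule sum_mono2)
    show "?A \<subseteq> (\<lambda>k. den r * k) ` ?B"
    proof
      fix d assume d: "d \<in> ?A"
      then obtain k where k: "d = den r * k" using den_dvd[OF r] by (auto elim: dvdE)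
      then have "1 \<le> k" "k \<le> d" using d den by (auto simp: Suc_le_eq)
      then have "k \<in> ?B" using d by auto
      then show "d \<in> (\<lambda>k. den r * k) ` ?B" using k by blast
    qed
  qed (auto intro: finite_nat_le_real)
  also have "\<dots> = (\<Sum>k\<in>?B. 1 / real (den r * k))"
    using den by (subst sum.reindex) (auto simp: inj_on_def)
  also have "\<dots> = (\<Sum>k\<in>?B. 1 / real k) / real (den r)"
    by (simp add: sum_divide_distrib mult.commute)
  also have "\<dots> \<le> (1 + ln D) / real (den r)"
    by (intro divide_right_mono harmonic_sum_real_le D) auto
  finally show ?thesis .
qed

text \<open>Orthogonality writes each congruence indicator modulo d as an average of characters over
  \<open>torsion d\<close>; swapping the sums over d and r collects equal frequencies.\<close>

lemma prog_sum_expansion: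
  "prog_sum f l D m = (\<Sum>r\<in>fractions D. freq_coeff f l D r * unit_char (real m * r))"
proof -
  let ?B = "{d. 1 \<le> d \<and> real d \<le> D}"
  have "(\<Sum>r\<in>fractions D. freq_coeff f l D r * unit_char (real m * r))
      = (\<Sum>r\<in>fractions D. \<Sum>d | d \<in> ?B \<and> real d * r \<in> \<int>.
          f d / of_nat d * unit_char (r * of_int (int m - l d)))"
    unfolding freq_coeff_def sum_distrib_right
    by (intro sum.cong) (auto simp: algebra_simps simp flip: unit_char_add)
  also have "\<dots> = (\<Sum>d\<in>?B. \<Sum>r | r \<in> fractions D \<and> real d * r \<in> \<int>.
          f d / of_nat d * unit_char (r * of_int (int m - l d)))"
    by (rule sum.swap_restrict) (auto intro: finite_nat_le_real)
  also have "\<dots> = (\<Sum>d\<in>?B. f d / of_nat d * (\<Sum>r\<in>torsion d. unit_char (r * of_int (int m - l d))))"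
    by (rule sum.cong) (auto simp: fractions_torsion sum_distrib_left)
  also have "\<dots> = (\<Sum>d\<in>?B. if [int m = l d] (mod int d) then f d else 0)"
    by (rule sum.cong) (auto simp: sum_torsion_unit_char cong_iff_dvd_diff simp del: of_int_diff)
  also have "\<dots> = prog_sum f l D m"
    unfolding prog_sum_def by (rule sum.mono_neutral_cong_right)
      (auto intro: finite_nat_le_real)
  finally show ?thesis ..
qed

text \<open>The nontrivial inclusion is Bezout: the gcd is an integer combination of d1 and
  d2.\<close>

lemma torsion_gcd:
  assumes "1 \<le> d1"
  shows "torsion (gcd d1 d2) = {r \<in> torsion d1. real d2 * r \<in> \<int>}"
proof -
  have "real (gcd d1 d2) * r \<in> \<int> \<longleftrightarrow> real d1 * r \<in> \<int> \<and> real d2 * r \<in> \<int>" for r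
  proof (intro iffI conjI)
    assume *: "real (gcd d1 d2) * r \<in> \<int>"
    show "real d1 * r \<in> \<int>"
    proof -
      obtain k where "d1 = gcd d1 d2 * k" by (meson dvdE gcd_dvd1)
      then have "real d1 * r = real k * (real (gcd d1 d2) * r)" by (metis mult.assoc mult.commute of_nat_mult)
      then show ?thesis using * by (metis Ints_mult Ints_of_nat)
    qed
    show "real d2 * r \<in> \<int>"
    proof -
      obtain k where "d2 = gcd d1 d2 * k" by (meson dvdE gcd_dvd2)
      then have "real d2 * r = real k * (real (gcd d1 d2) * r)" by (metis mult.assoc mult.commute of_nat_mult)
      then show ?thesis using * by (metis Ints_mult Ints_of_nat)
    qed
  next
    assume *: "real d1 * r \<in> \<int> \<and> real d2 * r \<in> \<int>"
    obtain u v where "u * int d1 + v * int d2 = gcd (int d1) (int d2)"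
      using bezout_int by blast
    then have "of_int (u * int d1 + v * int d2) = real (gcd d1 d2)"
      by (simp add: gcd_int_int_eq)
    then have "real (gcd d1 d2) * r = of_int u * (real d1 * r) + of_int v * (real d2 * r)"
      by (simp add: algebra_simps flip: \<open>of_int (u * int d1 + v * int d2) = real (gcd d1 d2)\<close>)
    then show "real (gcd d1 d2) * r \<in> \<int>" using * by auto
  qed
  then show ?thesis by (auto simp: torsion_def)
qed

text \<open>For fixed d1, d2 the common frequencies form \<open>torsion (gcd d1 d2)\<close>.
  Orthogonality over them yields the compatibility condition with weight gcd / (d1 d2) = 1 / lcm.
  Thus the expected main term consists of the diagonal frequencies in the product of the two
  expansions.\<close>

lemma main_term_expansion:
  "(\<Sum>d1 | 1 \<le> d1 \<and> real d1 \<le> D. \<Sum>d2 | 1 \<le> d2 \<and> real d2 \<le> D.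
      f1 d1 * f2 d2 * (of_bool ([l1 d1 + l2 d2 = int N] (mod int (gcd d1 d2))) / of_nat (lcm d1 d2)))
   = (\<Sum>r\<in>fractions D. freq_coeff f1 l1 D r * freq_coeff f2 l2 D r * unit_char (real N * r))"
proof -
  let ?B = "{d. 1 \<le> d \<and> real d \<le> D}"
  let ?g = "\<lambda>d1 d2 r. if real d1 * r \<in> \<int> \<and> real d2 * r \<in> \<int> then
      f1 d1 * f2 d2 / of_nat (d1 * d2) * unit_char (r * of_int (int N - l1 d1 - l2 d2)) else 0"
  have coeff: "freq_coeff f l D r = (\<Sum>d\<in>?B. if real d * r \<in> \<int> then
      f d / of_nat d * unit_char (- (r * of_int (l d))) else 0)" for f l r
    unfolding freq_coeff_def by (rule sum.mono_neutral_cong_left) (auto intro: finite_nat_le_real)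
  have "(\<Sum>r\<in>fractions D. freq_coeff f1 l1 D r * freq_coeff f2 l2 D r * unit_char (real N * r))
      = (\<Sum>r\<in>fractions D. \<Sum>d1\<in>?B. \<Sum>d2\<in>?B. ?g d1 d2 r)"
    unfolding coeff sum_product unfolding sum_distrib_right
  proof (intro sum.cong refl)
    fix r d1 d2
    have "unit_char (r * of_int (int N - l1 d1 - l2 d2))
        = unit_char (- (r * of_int (l1 d1))) * unit_char (- (r * of_int (l2 d2))) * unit_char (real N * r)"
      by (simp add: algebra_simps flip: unit_char_add)
    then show "(if real d1 * r \<in> \<int> then f1 d1 / of_nat d1 * unit_char (- (r * of_int (l1 d1))) else 0)
        * (if real d2 * r \<in> \<int> then f2 d2 / of_nat d2 * unit_char (- (r * of_int (l2 d2))) else 0)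
        * unit_char (real N * r) = ?g d1 d2 r"
      by simp
  qed
  also have "\<dots> = (\<Sum>d1\<in>?B. \<Sum>d2\<in>?B. \<Sum>r\<in>fractions D. ?g d1 d2 r)"
    by (rule sum_swap3)
  also have "\<dots> = (\<Sum>d1\<in>?B. \<Sum>d2\<in>?B. f1 d1 * f2 d2 *
      (of_bool ([l1 d1 + l2 d2 = int N] (mod int (gcd d1 d2))) / of_nat (lcm d1 d2)))"
  proof (intro sum.cong refl)
    fix d1 d2 assume d: "d1 \<in> ?B" "d2 \<in> ?B"
    have g1: "1 \<le> gcd d1 d2" using d by (simp add: Suc_le_eq)
    have tor: "torsion (gcd d1 d2) = {r \<in> fractions D. real d1 * r \<in> \<int> \<and> real d2 * r \<in> \<int>}"
      using d by (subst torsion_gcd) (auto simp flip: fractions_torsion)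
    have "(\<Sum>r\<in>fractions D. ?g d1 d2 r) = (\<Sum>r\<in>torsion (gcd d1 d2).
        f1 d1 * f2 d2 / of_nat (d1 * d2) * unit_char (r * of_int (int N - l1 d1 - l2 d2)))"
      unfolding tor by (rule sum.mono_neutral_cong_right) auto
    also have "\<dots> = f1 d1 * f2 d2 / of_nat (d1 * d2) *
        (if int (gcd d1 d2) dvd int N - l1 d1 - l2 d2 then of_nat (gcd d1 d2) else 0)"
      by (simp only: sum_torsion_unit_char[OF g1] flip: sum_distrib_left)
    also have "int (gcd d1 d2) dvd int N - l1 d1 - l2 d2
        \<longleftrightarrow> [l1 d1 + l2 d2 = int N] (mod int (gcd d1 d2))"
      unfolding cong_iff_dvd_diff by (subst dvd_diff_commute) (simp add: algebra_simps)
    also have "f1 d1 * f2 d2 / of_nat (d1 * d2)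
          * (if [l1 d1 + l2 d2 = int N] (mod int (gcd d1 d2)) then of_nat (gcd d1 d2) else 0)
        = f1 d1 * f2 d2 *
          (of_bool ([l1 d1 + l2 d2 = int N] (mod int (gcd d1 d2))) / of_nat (lcm d1 d2))"
    proof -
      have "(of_nat (d1 * d2) :: complex) = of_nat (gcd d1 d2) * of_nat (lcm d1 d2)"
        by (metis of_nat_mult prod_gcd_lcm_nat)
      then show ?thesis using g1 by simp
    qed
    finally show "(\<Sum>r\<in>fractions D. ?g d1 d2 r) = f1 d1 * f2 d2 *
      (of_bool ([l1 d1 + l2 d2 = int N] (mod int (gcd d1 d2))) / of_nat (lcm d1 d2))" .
  qed
  finally show ?thesis ..
qed

section \<open>The discrepancy as a convolution minus its diagonal frequencies\<close>

lemma representation_count_eq_sum: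
  "representation_count l1 l2 d1 d2 N = (\<Sum>m = 1..<N.
      of_bool ([int m = l1 d1] (mod int d1)) * of_bool ([int (N - m) = l2 d2] (mod int d2)))"
proof -
  let ?A = "{m \<in> {1..<N}. [int m = l1 d1] (mod int d1) \<and> [int (N - m) = l2 d2] (mod int d2)}"
  have "{(m, n). 1 \<le> m \<and> 1 \<le> n \<and> m + n = N \<and>
      [int m = l1 d1] (mod int d1) \<and> [int n = l2 d2] (mod int d2)} = (\<lambda>m. (m, N - m)) ` ?A"
    by (auto simp: image_iff)
  then have "representation_count l1 l2 d1 d2 N = card ((\<lambda>m. (m, N - m)) ` ?A)"
    by (simp add: representation_count_def)
  also have "\<dots> = card ?A" by (intro card_image) (auto simp: inj_on_def)
  also have "\<dots> = (\<Sum>m\<in>?A. 1)" by simp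
  also have "\<dots> = (\<Sum>m = 1..<N.
      of_bool ([int m = l1 d1] (mod int d1)) * of_bool ([int (N - m) = l2 d2] (mod int d2)))"
    by (rule sum.mono_neutral_cong_left) auto
  finally show ?thesis .
qed

lemma weighted_discrepancy_eq:
  "weighted_discrepancy l1 l2 f1 f2 D N
    = (\<Sum>m = 1..<N. prog_sum f1 l1 D m * prog_sum f2 l2 D (N - m))
      - of_nat N * (\<Sum>r\<in>fractions D. freq_coeff f1 l1 D r * freq_coeff f2 l2 D r * unit_char (real N * r))"
proof -
  let ?B = "{d. 1 \<le> d \<and> real d \<le> D}"
  have prog: "prog_sum f l D m = (\<Sum>d\<in>?B. f d * of_bool ([int m = l d] (mod int d)))" for f l m
    unfolding prog_sum_def by (rule sum.mono_neutral_cong_left) (auto intro: finite_nat_le_real)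
  have "(\<Sum>m = 1..<N. prog_sum f1 l1 D m * prog_sum f2 l2 D (N - m))
      = (\<Sum>m = 1..<N. \<Sum>d1\<in>?B. \<Sum>d2\<in>?B. f1 d1 * f2 d2 * (of_bool ([int m = l1 d1] (mod int d1))
          * of_bool ([int (N - m) = l2 d2] (mod int d2))))"
    unfolding prog sum_product by (intro sum.cong refl) (simp only: mult_ac)
  also have "\<dots> = (\<Sum>d1\<in>?B. \<Sum>d2\<in>?B. f1 d1 * f2 d2 * of_nat (representation_count l1 l2 d1 d2 N))"
    unfolding representation_count_eq_sum of_nat_sum sum_distrib_left of_nat_mult of_nat_of_bool
    by (rule sum_swap3)
  finally show ?thesis
    unfolding weighted_discrepancy_def main_term_expansion[symmetric] sum_distrib_left
    by (simp add: sum_subtractf algebra_simps)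
qed

text \<open>Allows a moment hypothesis on either sequence to be treated as one on the first.\<close>

lemma weighted_discrepancy_commute:
  "weighted_discrepancy l1 l2 f1 f2 D N = weighted_discrepancy l2 l1 f2 f1 D N"
proof -
  have "(\<Sum>m = 1..<N. prog_sum f1 l1 D m * prog_sum f2 l2 D (N - m))
      = (\<Sum>m = 1..<N. prog_sum f2 l2 D m * prog_sum f1 l1 D (N - m))"
    by (rule sum.reindex_bij_witness[of _ "\<lambda>m. N - m" "\<lambda>m. N - m"]) auto
  then show ?thesis unfolding weighted_discrepancy_eq by (simp add: mult_ac)
qed

section \<open>Mean values: counting in residue classes and Parseval\<close>

lemma card_cong_le:
  assumes "1 \<le> d"
  shows "card {m \<in> {1..M}. [int m = c] (mod int d)} \<le> M div d + 1"
proof -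
  \<comment> \<open>Within one residue class the quotient by d determines the number.\<close>
  have "card {m \<in> {1..M}. [int m = c] (mod int d)} \<le> card {..M div d}"
  proof (rule card_inj_on_le[where f = "\<lambda>m. m div d"])
    show "inj_on (\<lambda>m. m div d) {m \<in> {1..M}. [int m = c] (mod int d)}"
    proof (rule inj_onI)
      fix m n assume *: "m \<in> {m \<in> {1..M}. [int m = c] (mod int d)}"
        "n \<in> {m \<in> {1..M}. [int m = c] (mod int d)}" "m div d = n div d"
      then have "[int m = int n] (mod int d)" using cong_sym cong_trans by blast
      then have "m mod d = n mod d" by (simp only: cong_int_iff) (simp add: Cong.cong_def)
      then show "m = n" using *(3) by (metis div_mult_mod_eq)
    qed
  qed (auto intro: div_le_mono)
  then show ?thesis by simp
qed

lemma norm_prog_sum_le: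
  assumes "\<And>n. 1 \<le> n \<Longrightarrow> cmod (f n) \<le> 1"
  shows "cmod (prog_sum f l D m) \<le> (\<Sum>d | 1 \<le> d \<and> real d \<le> D \<and> [int m = l d] (mod int d). 1)"
  unfolding prog_sum_def using assms by (intro sum_norm_le) auto

text \<open>After exchanging the sums, each d accounts for at most M/d + 1 values of m, and 1 <= Y/d
  because d <= D <= Y.\<close>

lemma sum_norm_prog_sum_le:
  assumes D: "1 \<le> D" "D \<le> Y" and M: "real M \<le> Y" and f: "\<And>n. 1 \<le> n \<Longrightarrow> cmod (f n) \<le> 1"
  shows "(\<Sum>m = 1..M. cmod (prog_sum f l D m)) \<le> 2 * Y * (1 + ln D)"
proof -
  let ?B = "{d. 1 \<le> d \<and> real d \<le> D}"
  have "(\<Sum>m = 1..M. cmod (prog_sum f l D m))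
      \<le> (\<Sum>m = 1..M. \<Sum>d | d \<in> ?B \<and> [int m = l d] (mod int d). 1)"
    using norm_prog_sum_le[of f l D] f by (intro sum_mono) (simp add: conj_assoc)
  also have "\<dots> = (\<Sum>d\<in>?B. \<Sum>m | m \<in> {1..M} \<and> [int m = l d] (mod int d). 1)"
    by (rule sum.swap_restrict) (auto intro: finite_nat_le_real)
  also have "\<dots> \<le> (\<Sum>d\<in>?B. 2 * Y * (1 / real d))"
  proof (rule sum_mono)
    fix d assume d: "d \<in> ?B"
    have "(\<Sum>m | m \<in> {1..M} \<and> [int m = l d] (mod int d). 1::real)
        = real (card {m \<in> {1..M}. [int m = l d] (mod int d)})" by simp
    also have "\<dots> \<le> real (M div d + 1)"
      using d by (intro of_nat_mono card_cong_le) auto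
    also have "\<dots> \<le> real M / real d + 1" using of_nat_div_le_of_nat[of M d, where ?'a = real] by simp
    also have "\<dots> \<le> Y / real d + Y / real d"
      using d D M by (intro add_mono divide_right_mono) auto
    finally show "(\<Sum>m | m \<in> {1..M} \<and> [int m = l d] (mod int d). 1) \<le> 2 * Y * (1 / real d)"
      by simp
  qed
  also have "\<dots> = 2 * Y * (\<Sum>d\<in>?B. 1 / real d)" by (simp add: sum_distrib_left)
  also have "\<dots> \<le> 2 * Y * (1 + ln D)"
    using D by (intro mult_left_mono harmonic_sum_real_le) auto
  finally show ?thesis .
qed

text \<open>Parseval on the cyclic group of order M: for n, k < M the difference n - k is divisible
  by M only if n = k.\<close>

lemma parseval_torsion:
  assumes "1 \<le> M"
  shows "(\<Sum>r\<in>torsion M. (cmod (\<Sum>n<M. x n * unit_char (real n * r)))\<^sup>2) = real M * (\<Sum>n<M. (cmod (x n))\<^sup>2)"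
proof -
  have "complex_of_real (\<Sum>r\<in>torsion M. (cmod (\<Sum>n<M. x n * unit_char (real n * r)))\<^sup>2)
      = (\<Sum>r\<in>torsion M. \<Sum>n<M. \<Sum>k<M. x n * cnj (x k) * unit_char (r * of_int (int n - int k)))"
    unfolding of_real_sum complex_norm_square cnj_sum sum_product
    by (intro sum.cong refl) (simp add: cnj_unit_char algebra_simps flip: unit_char_add)
  also have "\<dots> = (\<Sum>n<M. \<Sum>k<M. \<Sum>r\<in>torsion M. x n * cnj (x k) * unit_char (r * of_int (int n - int k)))"
    by (rule sum_swap3)
  also have "\<dots> = (\<Sum>n<M. \<Sum>k<M. if k = n then x n * cnj (x k) * of_nat M else 0)"
  proof (intro sum.cong refl)
    fix n k assume nk: "n \<in> {..<M}" "k \<in> {..<M}"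
    have "int M dvd int n - int k \<longleftrightarrow> k = n"
    proof
      assume "int M dvd int n - int k"
      then have "[int n = int k] (mod int M)" by (simp add: cong_iff_dvd_diff)
      then have "[n = k] (mod M)" by (simp only: cong_int_iff)
      then show "k = n" using nk by (simp add: Cong.cong_def)
    qed simp
    then show "(\<Sum>r\<in>torsion M. x n * cnj (x k) * unit_char (r * of_int (int n - int k)))
        = (if k = n then x n * cnj (x k) * of_nat M else 0)"
      using sum_torsion_unit_char[OF assms, of "int n - int k"]
      by (simp only: flip: sum_distrib_left) auto
  qed
  also have "\<dots> = complex_of_real (real M * (\<Sum>n<M. (cmod (x n))\<^sup>2))"
    by (simp add: complex_norm_square[symmetric] sum_distrib_left mult_ac)
  finally show ?thesis by (simp only: of_real_eq_iff)
qed

text \<open>On the Fourier side convolution is multiplication, so a uniform bound for the transform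
  of y can be pulled out before Parseval is applied to x.\<close>

lemma convolution_mean_square_le:
  assumes B: "\<And>r. cmod (\<Sum>n = 1..K. y n * unit_char (real n * r)) \<le> B"
  shows "(\<Sum>N = 1..K. (cmod (\<Sum>m = 1..<N. x m * y (N - m)))\<^sup>2) \<le> B\<^sup>2 * (\<Sum>m = 1..K. (cmod (x m))\<^sup>2)"
proof -
  \<comment> \<open>Sums m + n with m, n <= K are at most 2K, so no two distinct ones agree modulo
    2K + 1 and there is no wraparound.\<close>
  define M where "M = 2 * K + 1"
  have M: "1 \<le> M" "0 < real M" by (auto simp: M_def)
  let ?P = "{1..K} \<times> {1..K}"
  \<comment> \<open>\<open>c\<close> is the full convolution of the restrictions to 1..K. For N <= K
    the condition n <= K is automatic, so it agrees with the sum in the statement; values beyond K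
    only increase the total.\<close>
  define c where "c N = (\<Sum>(m, n) | (m, n) \<in> ?P \<and> m + n = N. x m * y n)" for N
  define u where "u m = (if m \<in> {1..K} then x m else 0)" for m
  have c_eq: "c N = (\<Sum>m = 1..<N. x m * y (N - m))" if "N \<in> {1..K}" for N
    unfolding c_def by (rule sum.reindex_bij_witness[of _ "\<lambda>m. (m, N - m)" fst]) (use that in auto)
  have c_hat: "(\<Sum>N<M. c N * unit_char (real N * r))
      = (\<Sum>m<M. u m * unit_char (real m * r)) * (\<Sum>n = 1..K. y n * unit_char (real n * r))" for r
  proof -
    have "(\<Sum>N<M. c N * unit_char (real N * r))
        = (\<Sum>N<M. \<Sum>p | p \<in> ?P \<and> fst p + snd p = N. x (fst p) * y (snd p) * unit_char (real (fst p + snd p) * r))"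
      unfolding c_def sum_distrib_right by (intro sum.cong refl) (auto simp: case_prod_unfold)
    also have "\<dots> = (\<Sum>p\<in>?P. x (fst p) * y (snd p) * unit_char (real (fst p + snd p) * r))"
      by (rule sum.group) (auto simp: M_def)
    also have "\<dots> = (\<Sum>m = 1..K. x m * unit_char (real m * r)) * (\<Sum>n = 1..K. y n * unit_char (real n * r))"
      unfolding sum_product sum.cartesian_product
      by (intro sum.cong refl) (auto simp: case_prod_unfold distrib_left mult_ac simp flip: unit_char_add)
    also have "(\<Sum>m = 1..K. x m * unit_char (real m * r)) = (\<Sum>m<M. u m * unit_char (real m * r))"
      by (rule sum.mono_neutral_cong_left) (auto simp: M_def u_def)
    finally show ?thesis .
  qed
  have "(\<Sum>N = 1..K. (cmod (\<Sum>m = 1..<N. x m * y (N - m)))\<^sup>2) = (\<Sum>N = 1..K. (cmod (c N))\<^sup>2)"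
    by (intro sum.cong refl) (simp add: c_eq)
  also have "\<dots> \<le> (\<Sum>N<M. (cmod (c N))\<^sup>2)" by (rule sum_mono2) (auto simp: M_def)
  finally have "real M * (\<Sum>N = 1..K. (cmod (\<Sum>m = 1..<N. x m * y (N - m)))\<^sup>2)
      \<le> real M * (\<Sum>N<M. (cmod (c N))\<^sup>2)"
    using M by (intro mult_left_mono) auto
  also have "\<dots> = (\<Sum>r\<in>torsion M. (cmod (\<Sum>N<M. c N * unit_char (real N * r)))\<^sup>2)"
    by (rule parseval_torsion[OF M(1), symmetric])
  also have "\<dots> \<le> (\<Sum>r\<in>torsion M. B\<^sup>2 * (cmod (\<Sum>m<M. u m * unit_char (real m * r)))\<^sup>2)"
    unfolding c_hat norm_mult power_mult_distrib
    by (subst mult.commute, intro sum_mono mult_right_mono power_mono B) auto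
  also have "\<dots> = real M * (B\<^sup>2 * (\<Sum>m<M. (cmod (u m))\<^sup>2))"
    by (simp add: parseval_torsion[OF M(1)] flip: sum_distrib_left)
  also have "(\<Sum>m<M. (cmod (u m))\<^sup>2) = (\<Sum>m = 1..K. (cmod (x m))\<^sup>2)"
    by (rule sum.mono_neutral_cong_right) (auto simp: M_def u_def)
  finally show ?thesis using M by simp
qed

section \<open>Splitting into low and high frequencies\<close>

text \<open>The map (N, m) -> (m, N - m) is injective into the square of pairs up to K, and all
  terms are nonnegative.\<close>

lemma sum_convolution_le:
  fixes u v :: "nat \<Rightarrow> real"
  assumes "\<And>n. 0 \<le> u n" "\<And>n. 0 \<le> v n"
  shows "(\<Sum>N = 1..K. \<Sum>m = 1..<N. u m * v (N - m)) \<le> (\<Sum>m = 1..K. u m) * (\<Sum>n = 1..K. v n)"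
proof -
  have "(\<Sum>N = 1..K. \<Sum>m = 1..<N. u m * v (N - m))
      = (\<Sum>(N, m)\<in>(SIGMA N:{1..K}. {1..<N}). u m * v (N - m))"
    by (simp add: sum.Sigma)
  also have "\<dots> = (\<Sum>(m, n) | m \<in> {1..K} \<and> n \<in> {1..K} \<and> m + n \<le> K. u m * v n)"
    by (rule sum.reindex_bij_witness[of _ "\<lambda>(m, n). (m + n, m)" "\<lambda>(N, m). (m, N - m)"]) auto
  also have "\<dots> \<le> (\<Sum>(m, n)\<in>{1..K} \<times> {1..K}. u m * v n)"
    using assms by (intro sum_mono2) auto
  also have "\<dots> = (\<Sum>m = 1..K. u m) * (\<Sum>n = 1..K. v n)"
    by (simp add: sum_product sum.cartesian_product)
  finally show ?thesis .
qed

text \<open>Markov's inequality, used to turn mean bounds into bounds for exceptional sets.\<close>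

lemma card_large_values_le:
  fixes g :: "'a \<Rightarrow> real"
  assumes "finite S" "\<And>n. n \<in> S \<Longrightarrow> 0 \<le> g n" "(\<Sum>n\<in>S. g n) \<le> W * V" "0 < V"
  shows "real (card {n \<in> S. V < g n}) \<le> W"
proof -
  have "real (card {n \<in> S. V < g n}) * V = (\<Sum>n | n \<in> S \<and> V < g n. V)" by simp
  also have "\<dots> \<le> (\<Sum>n | n \<in> S \<and> V < g n. g n)" by (intro sum_mono) auto
  also have "\<dots> \<le> (\<Sum>n\<in>S. g n)" using assms by (intro sum_mono2) auto
  also have "\<dots> \<le> W * V" by (rule assms)
  finally show ?thesis using assms(4) by simp
qed

text \<open>The range D and the splitting point Q stay free here, so the estimates are explicit in
  X, D, Q and \<open>L\<close>; powers of X are inserted only at the end.\<close>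

locale progression_pair =
  fixes l1 l2 :: "nat \<Rightarrow> int" and f1 f2 :: "nat \<Rightarrow> complex" and X D Q :: real
  assumes Q: "1 \<le> Q" and D: "1 \<le> D" "D \<le> X"
    and f1: "\<And>n. 1 \<le> n \<Longrightarrow> cmod (f1 n) \<le> 1" and f2: "\<And>n. 1 \<le> n \<Longrightarrow> cmod (f2 n) \<le> 1"
begin

definition "L = 1 + ln X"
definition "K = nat \<lfloor>X\<rfloor>"
definition "low = {r \<in> fractions D. real (den r) \<le> Q}"
definition "high = {r \<in> fractions D. Q < real (den r)}"

abbreviation "a \<equiv> prog_sum f1 l1 D"
abbreviation "b \<equiv> prog_sum f2 l2 D"
abbreviation "A \<equiv> freq_coeff f1 l1 D"
abbreviation "B \<equiv> freq_coeff f2 l2 D"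

definition "b_low n = (\<Sum>r\<in>low. B r * unit_char (real n * r))"
definition "b_high n = (\<Sum>r\<in>high. B r * unit_char (real n * r))"

text \<open>The cut at D matches the lower end of the sum in \<open>second_moment\<close>.\<close>

definition "a_small m = (if real m \<le> D then a m else 0)"
definition "a_large m = (if real m \<le> D then 0 else a m)"

lemma L_ge_1: "1 \<le> L"
  using D by (simp add: L_def)

lemma ln_D_le: "1 + ln D \<le> L"
  using D by (simp add: L_def)

lemma K_le: "real K \<le> X"
  using D by (simp add: K_def)

lemma finite_low [simp]: "finite low" and finite_high [simp]: "finite high"
  by (simp_all add: low_def high_def)

lemma norm_A_le: "r \<in> fractions D \<Longrightarrow> cmod (A r) \<le> L / real (den r)"
  by (rule order_trans[OF norm_freq_coeff_le[OF D(1) f1]]) (use ln_D_le in \<open>auto intro: divide_right_mono\<close>)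

lemma norm_B_le: "r \<in> fractions D \<Longrightarrow> cmod (B r) \<le> L / real (den r)"
  by (rule order_trans[OF norm_freq_coeff_le[OF D(1) f2]]) (use ln_D_le in \<open>auto intro: divide_right_mono\<close>)

lemma fractions_split: "fractions D = low \<union> high" "low \<inter> high = {}"
  by (auto simp: low_def high_def)

lemma b_split: "b n = b_low n + b_high n"
  unfolding prog_sum_expansion b_low_def b_high_def
  by (subst fractions_split(1), rule sum.union_disjoint) (auto simp: fractions_split)

lemma a_split: "a m = a_small m + a_large m"
  by (simp add: a_small_def a_large_def)

text \<open>The weight 1 / \<open>den r\<close> cancels the number of fractions with a given
  denominator, so each denominator up to Q costs at most \<open>L\<close>.\<close>

lemma sum_low_inverse_den_le: "(\<Sum>r\<in>low. L / real (den r)) \<le> L * Q"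
proof -
  have "(\<Sum>r\<in>low. L / real (den r)) = L * (\<Sum>r\<in>low. 1 / real (den r))"
    by (simp add: sum_distrib_left)
  also have "\<dots> \<le> L * Q"
    using sum_fractions_inverse_den_le[OF Q, of D] L_ge_1
    by (intro mult_left_mono) (auto simp: low_def)
  finally show ?thesis .
qed

text \<open>Uniform in M because \<open>a_small\<close> vanishes beyond D, so the mean value bound
  with Y = D suffices.\<close>

lemma sum_norm_a_small_le: "(\<Sum>m = 1..M. cmod (a_small m)) \<le> 2 * D * L"
proof -
  have "(\<Sum>m = 1..M. cmod (a_small m)) = (\<Sum>m | m \<in> {1..M} \<and> real m \<le> D. cmod (a m))"
    by (rule sum.mono_neutral_cong_right) (auto simp: a_small_def)
  also have "\<dots> \<le> (\<Sum>m = 1..nat \<lfloor>D\<rfloor>. cmod (a m))"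
    by (rule sum_mono2) (auto simp: le_nat_floor)
  also have "\<dots> \<le> 2 * D * (1 + ln D)"
    using D by (intro sum_norm_prog_sum_le f1) auto
  also have "\<dots> \<le> 2 * D * L" using D ln_D_le by (intro mult_left_mono) auto
  finally show ?thesis .
qed

text \<open>Summing over N decouples the convolution: short m contribute O(D L) and n <= X
  contributes O(X L).\<close>

lemma sum_norm_small_conv_le:
  "(\<Sum>N = 1..K. cmod (\<Sum>m = 1..<N. a_small m * b (N - m))) \<le> 4 * D * X * L\<^sup>2"
proof -
  have "(\<Sum>N = 1..K. cmod (\<Sum>m = 1..<N. a_small m * b (N - m)))
      \<le> (\<Sum>N = 1..K. \<Sum>m = 1..<N. cmod (a_small m) * cmod (b (N - m)))"
    by (intro sum_mono sum_norm_le) (simp add: norm_mult)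
  also have "\<dots> \<le> (\<Sum>m = 1..K. cmod (a_small m)) * (\<Sum>n = 1..K. cmod (b n))"
    by (rule sum_convolution_le) auto
  also have "\<dots> \<le> (2 * D * L) * (2 * X * (1 + ln D))"
    using D L_ge_1 K_le by (intro mult_mono sum_norm_a_small_le sum_norm_prog_sum_le f2 sum_nonneg) auto
  also have "\<dots> \<le> (2 * D * L) * (2 * X * L)"
    using D L_ge_1 ln_D_le by (intro mult_left_mono) auto
  finally show ?thesis by (simp add: power2_eq_square mult_ac)
qed

lemma norm_b_low_le: "cmod (b_low n) \<le> L * Q"
proof -
  have "cmod (b_low n) \<le> (\<Sum>r\<in>low. L / real (den r))"
    unfolding b_low_def by (intro sum_norm_le) (simp add: norm_mult norm_B_le low_def)
  then show ?thesis using sum_low_inverse_den_le by simp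
qed

text \<open>Compensates for pairing \<open>b_low\<close> with all of \<open>a\<close>. The pointwise
  bound for \<open>b_low\<close> makes averaging over N unnecessary here.\<close>

lemma norm_small_low_conv_le:
  "cmod (\<Sum>m = 1..<N. a_small m * b_low (N - m)) \<le> 2 * D * Q * L\<^sup>2"
proof -
  have "cmod (\<Sum>m = 1..<N. a_small m * b_low (N - m)) \<le> (\<Sum>m = 1..<N. cmod (a_small m) * (L * Q))"
    using norm_b_low_le by (intro sum_norm_le) (simp add: norm_mult mult_left_mono)
  also have "\<dots> \<le> (\<Sum>m = 1..N. cmod (a_small m) * (L * Q))"
    using L_ge_1 Q by (intro sum_mono2) auto
  also have "\<dots> = (\<Sum>m = 1..N. cmod (a_small m)) * (L * Q)" by (simp add: sum_distrib_right)
  also have "\<dots> \<le> (2 * D * L) * (L * Q)"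
    using L_ge_1 Q by (intro mult_right_mono sum_norm_a_small_le) auto
  finally show ?thesis by (simp add: power2_eq_square mult_ac)
qed

lemma sum_high_geom_bound_le:
  "(\<Sum>r\<in>high. geom_bound X (\<alpha> - r) / real (den r)) \<le> 56 * L\<^sup>2 * (X / Q + D)"
proof -
  have "(\<Sum>r\<in>high. geom_bound X (\<alpha> - r) / real (den r))
      \<le> (\<Sum>s | s \<in> fractions D \<and> Q \<le> real (den s). geom_bound X (\<alpha> - s) / real (den s))"
    using D by (intro sum_mono2) (auto simp: high_def intro!: divide_nonneg_nonneg geom_bound_nonneg)
  also have "\<dots> \<le> 56 * L\<^sup>2 * (X / Q + D)"
    unfolding L_def using D Q by (intro sum_geom_bound_fractions_le) auto
  finally show ?thesis .
qed

lemma sum_unit_char_K_le: "cmod (\<Sum>n = 1..K. unit_char (real n * x)) \<le> geom_bound X x"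
  using norm_sum_unit_char_le[of "Suc K" 1 X x] K_le by (simp add: atLeastLessThanSuc_atLeastAtMost)

text \<open>Each frequency r contributes a geometric sum at x + r; the estimate for spaced fractions
  with centre -x then gives a bound uniform in x. Restricting to denominators above Q is what
  produces X / Q.\<close>

lemma norm_b_high_transform_le:
  "cmod (\<Sum>n = 1..K. b_high n * unit_char (real n * x)) \<le> 56 * L ^ 3 * (X / Q + D)"
proof -
  have "(\<Sum>n = 1..K. b_high n * unit_char (real n * x))
      = (\<Sum>n = 1..K. \<Sum>r\<in>high. B r * unit_char (real n * (x + r)))"
    unfolding b_high_def sum_distrib_right
    by (intro sum.cong refl) (simp add: distrib_left unit_char_add mult_ac)
  also have "\<dots> = (\<Sum>r\<in>high. B r * (\<Sum>n = 1..K. unit_char (real n * (x + r))))"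
    by (subst sum.swap) (simp add: sum_distrib_left)
  also have "cmod \<dots> \<le> (\<Sum>r\<in>high. L / real (den r) * geom_bound X (- x - r))"
  proof (rule sum_norm_le)
    fix r assume "r \<in> high"
    then have "cmod (B r) \<le> L / real (den r)" by (simp add: norm_B_le high_def)
    moreover have "geom_bound X (- x - r) = geom_bound X (x + r)"
      using geom_bound_uminus[of X "x + r"] by simp
    ultimately show "cmod (B r * (\<Sum>n = 1..K. unit_char (real n * (x + r))))
        \<le> L / real (den r) * geom_bound X (- x - r)"
      using sum_unit_char_K_le[of "x + r"] L_ge_1 by (simp only: norm_mult) (intro mult_mono, auto)
  qed
  also have "\<dots> = L * (\<Sum>r\<in>high. geom_bound X (- x - r) / real (den r))"
    by (simp add: sum_distrib_left)
  also have "\<dots> \<le> L * (56 * L\<^sup>2 * (X / Q + D))"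
    using L_ge_1 by (intro mult_left_mono sum_high_geom_bound_le) auto
  finally show ?thesis by (simp add: power2_eq_square power3_eq_cube mult_ac)
qed

lemma sum_a_large_sq_le: "(\<Sum>m = 1..K. (cmod (a_large m))\<^sup>2) \<le> second_moment l1 D X"
proof -
  have "(\<Sum>m = 1..K. (cmod (a_large m))\<^sup>2) = (\<Sum>m | D < real m \<and> real m \<le> X. (cmod (a m))\<^sup>2)"
  proof (rule sum.mono_neutral_cong_right)
    show "{m. D < real m \<and> real m \<le> X} \<subseteq> {1..K}"
      using D by (auto simp: K_def le_nat_floor Suc_le_eq intro: gr0I)
  qed (use K_le in \<open>auto simp: a_large_def not_le\<close>)
  also have "\<dots> \<le> second_moment l1 D X"
    unfolding second_moment_def
    by (intro sum_mono power_mono norm_prog_sum_le f1) auto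
  finally show ?thesis .
qed

text \<open>The uniform transform bound takes care of \<open>b_high\<close>, leaving only the square
  sum of \<open>a_large\<close>; this is where the second moment enters.\<close>

lemma mean_square_large_high_conv_le:
  "(\<Sum>N = 1..K. (cmod (\<Sum>m = 1..<N. a_large m * b_high (N - m)))\<^sup>2)
    \<le> (56 * L ^ 3 * (X / Q + D))\<^sup>2 * second_moment l1 D X"
proof -
  have "(\<Sum>N = 1..K. (cmod (\<Sum>m = 1..<N. a_large m * b_high (N - m)))\<^sup>2)
    \<le> (56 * L ^ 3 * (X / Q + D))\<^sup>2 * (\<Sum>m = 1..K. (cmod (a_large m))\<^sup>2)"
    by (rule convolution_mean_square_le) (rule norm_b_high_transform_le)
  also have "\<dots> \<le> (56 * L ^ 3 * (X / Q + D))\<^sup>2 * second_moment l1 D X"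
    by (intro mult_left_mono sum_a_large_sq_le) auto
  finally show ?thesis .
qed

text \<open>Since r has denominator at most Q, every other s is at distance at least 1 / (Q D). The
  sums over m are therefore bounded by \<open>geom_bound (Q * D)\<close> independently of N, and the
  estimate for spaced fractions applies with Y = Q D and cutoff 1.\<close>

lemma sum_off_diagonal_le:
  assumes r: "r \<in> low"
  shows "(\<Sum>s\<in>fractions D - {r}. L / real (den s) * cmod (\<Sum>m = 1..<N. unit_char (real m * (s - r))))
    \<le> 112 * L ^ 3 * (Q * D)"
proof -
  have rD: "r \<in> fractions D" "real (den r) \<le> Q" using r by (auto simp: low_def)
  have "(\<Sum>s\<in>fractions D - {r}. L / real (den s) * cmod (\<Sum>m = 1..<N. unit_char (real m * (s - r))))
      \<le> (\<Sum>s\<in>fractions D - {r}. L / real (den s) * geom_bound (Q * D) (r - s))"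
  proof (intro sum_mono mult_left_mono)
    fix s assume s: "s \<in> fractions D - {r}"
    have ni: "s - r \<notin> \<int>" using s rD by (intro fractions_diff_not_Ints) auto
    have "real (den r) * real (den s) \<le> Q * D"
      using rD s den_props(3)[of s D] Q by (intro mult_mono) auto
    then have "1 / (Q * D) \<le> 1 / (real (den r) * real (den s))"
      using den_props(1)[OF rD(1)] den_props(1)[of s D] s
      by (intro divide_left_mono mult_pos_pos) (use Q D in \<open>auto simp: Suc_le_eq\<close>)
    also have "\<dots> \<le> int_dist (r - s)" using s rD by (intro fractions_spacing) auto
    finally have "geom_bound (Q * D) (r - s) = 1 / int_dist (r - s)"
      using Q D by (intro geom_bound_eq_inverse) auto
    moreover have "cmod (\<Sum>m = 1..<N. unit_char (real m * (s - r))) \<le> geom_bound (real N) (s - r)"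
      by (rule norm_sum_unit_char_le) auto
    moreover have "geom_bound (real N) (s - r) \<le> 1 / int_dist (s - r)"
      by (rule geom_bound_le_inverse) (use int_dist_pos[OF ni] in auto)
    ultimately show "cmod (\<Sum>m = 1..<N. unit_char (real m * (s - r))) \<le> geom_bound (Q * D) (r - s)"
      by (simp add: int_dist_commute)
  qed (use L_ge_1 in auto)
  also have "\<dots> \<le> (\<Sum>s | s \<in> fractions D \<and> 1 \<le> real (den s). L / real (den s) * geom_bound (Q * D) (r - s))"
    using den_props(1) Q D L_ge_1
    by (intro sum_mono2) (auto intro!: mult_nonneg_nonneg divide_nonneg_nonneg geom_bound_nonneg)
  also have "\<dots> = L * (\<Sum>s | s \<in> fractions D \<and> 1 \<le> real (den s). geom_bound (Q * D) (r - s) / real (den s))"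
    by (simp add: sum_distrib_left)
  also have "\<dots> \<le> L * (56 * L\<^sup>2 * (Q * D / 1 + D))"
    unfolding L_def using D Q L_ge_1[unfolded L_def]
    by (intro mult_left_mono sum_geom_bound_fractions_le) auto
  also have "\<dots> \<le> L * (56 * L\<^sup>2 * (2 * (Q * D)))"
    using L_ge_1 Q D by (intro mult_left_mono) auto
  finally show ?thesis by (simp add: power2_eq_square power3_eq_cube mult_ac)
qed

text \<open>When \<open>a\<close> is expanded too, the terms s = r reproduce the low part of the
  main term, and the others are the off-diagonal sums just bounded.\<close>

lemma norm_low_conv_minus_main_le:
  assumes N: "1 \<le> N"
  shows "cmod ((\<Sum>m = 1..<N. a m * b_low (N - m))
      - of_nat N * (\<Sum>r\<in>low. A r * B r * unit_char (real N * r))) \<le> 113 * L ^ 4 * Q\<^sup>2 * D"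
proof -
  define G where "G s r = (\<Sum>m = 1..<N. unit_char (real m * (s - r)))" for s r
  define H where "H r = (\<Sum>s\<in>fractions D - {r}. A s * G s r)" for r
  have "(\<Sum>m = 1..<N. a m * b_low (N - m))
      = (\<Sum>m = 1..<N. \<Sum>r\<in>low. \<Sum>s\<in>fractions D. B r * unit_char (real N * r) *
          (A s * unit_char (real m * (s - r))))"
  proof (intro sum.cong refl)
    fix m assume m: "m \<in> {1..<N}"
    have e: "unit_char (real m * s) * unit_char (real (N - m) * r)
        = unit_char (real N * r) * unit_char (real m * (s - r))" for r s
      using m by (simp add: of_nat_diff algebra_simps flip: unit_char_add)
    have "a m * b_low (N - m) = (\<Sum>r\<in>low. \<Sum>s\<in>fractions D.
        A s * unit_char (real m * s) * (B r * unit_char (real (N - m) * r)))"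
      unfolding prog_sum_expansion[of f1] b_low_def sum_product by (rule sum.swap)
    also have "\<dots> = (\<Sum>r\<in>low. \<Sum>s\<in>fractions D. B r * unit_char (real N * r) *
          (A s * unit_char (real m * (s - r))))"
    proof (intro sum.cong refl)
      fix r s
      have "A s * unit_char (real m * s) * (B r * unit_char (real (N - m) * r))
          = A s * B r * (unit_char (real m * s) * unit_char (real (N - m) * r))" by (simp only: mult_ac)
      also have "\<dots> = B r * unit_char (real N * r) * (A s * unit_char (real m * (s - r)))"
        unfolding e by (simp only: mult_ac)
      finally show "A s * unit_char (real m * s) * (B r * unit_char (real (N - m) * r)) = \<dots>" .
    qed
    finally show "a m * b_low (N - m) = \<dots>" .
  qed
  also have "\<dots> = (\<Sum>r\<in>low. B r * unit_char (real N * r) * (\<Sum>s\<in>fractions D. A s * G s r))"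
    unfolding G_def sum_distrib_left by (rule sum_swap3)
  \<comment> \<open>The diagonal sum over m has N - 1 terms, not N. The missing one leaves
    \<open>- A r\<close>, which raises the constant from 112 to 113.\<close>
  also have "\<dots> = (\<Sum>r\<in>low. B r * unit_char (real N * r) * (A r * (of_nat N - 1) + H r))"
  proof (intro sum.cong refl)
    fix r assume "r \<in> low"
    then have "(\<Sum>s\<in>fractions D. A s * G s r) = A r * G r r + H r"
      unfolding H_def by (intro sum.remove) (auto simp: low_def)
    moreover have "G r r = of_nat N - 1" using N by (simp add: G_def of_nat_diff)
    ultimately show "B r * unit_char (real N * r) * (\<Sum>s\<in>fractions D. A s * G s r)
        = B r * unit_char (real N * r) * (A r * (of_nat N - 1) + H r)" by simp
  qed
  finally have "(\<Sum>m = 1..<N. a m * b_low (N - m))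
      - of_nat N * (\<Sum>r\<in>low. A r * B r * unit_char (real N * r))
      = (\<Sum>r\<in>low. B r * unit_char (real N * r) * (A r * (of_nat N - 1) + H r)
          - of_nat N * (A r * B r * unit_char (real N * r)))"
    by (simp only: sum_distrib_left sum_subtractf)
  also have "\<dots> = (\<Sum>r\<in>low. B r * unit_char (real N * r) * (H r - A r))"
    by (intro sum.cong refl) (simp add: algebra_simps)
  also have "cmod \<dots> \<le> (\<Sum>r\<in>low. L / real (den r) * (113 * L ^ 3 * (Q * D)))"
  proof (rule sum_norm_le)
    fix r assume r: "r \<in> low"
    then have rD: "r \<in> fractions D" by (simp add: low_def)
    have "cmod (H r) \<le> 112 * L ^ 3 * (Q * D)"
    proof -
      have "cmod (H r) \<le> (\<Sum>s\<in>fractions D - {r}. L / real (den s) * cmod (G s r))"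
        unfolding H_def
      proof (rule sum_norm_le)
        fix s assume "s \<in> fractions D - {r}"
        then show "cmod (A s * G s r) \<le> L / real (den s) * cmod (G s r)"
          unfolding norm_mult by (intro mult_right_mono norm_A_le) auto
      qed
      then show ?thesis using sum_off_diagonal_le[OF r, of N] unfolding G_def by linarith
    qed
    moreover have "cmod (A r) \<le> L ^ 3 * (Q * D)"
    proof -
      have "cmod (A r) \<le> L / real (den r)" by (rule norm_A_le[OF rD])
      also have "\<dots> \<le> L" using den_props(1)[OF rD] L_ge_1 by (simp add: divide_le_eq mult_le_cancel_left1)
      also have "\<dots> \<le> L ^ 3" using L_ge_1 by (rule self_le_power) auto
      also have "\<dots> \<le> L ^ 3 * (Q * D)"
      proof -
        have "1 * 1 \<le> Q * D" using Q D by (intro mult_mono) auto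
        then show ?thesis using L_ge_1 by (simp add: mult_le_cancel_left1)
      qed
      finally show ?thesis .
    qed
    ultimately have "cmod (H r - A r) \<le> 113 * L ^ 3 * (Q * D)"
      using norm_triangle_ineq4[of "H r" "A r"] by linarith
    then show "cmod (B r * unit_char (real N * r) * (H r - A r))
        \<le> L / real (den r) * (113 * L ^ 3 * (Q * D))"
      unfolding norm_mult norm_unit_char mult_1_right
      using norm_B_le[OF rD] L_ge_1 by (intro mult_mono) auto
  qed
  also have "\<dots> = (\<Sum>r\<in>low. L / real (den r)) * (113 * L ^ 3 * (Q * D))"
    by (simp only: sum_distrib_right)
  also have "\<dots> \<le> L * Q * (113 * L ^ 3 * (Q * D))"
    using L_ge_1 Q D by (intro mult_right_mono sum_low_inverse_den_le) auto
  also have "\<dots> = 113 * L ^ 4 * Q\<^sup>2 * D" by (simp add: power2_eq_square power3_eq_cube power4_eq_xxxx)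
  finally show ?thesis .
qed

text \<open>Squaring out gives a double sum over r and s with kernel
  \<open>geom_bound X (r - s)\<close>. The coefficients have size L^2 / den^2: for s, one factor 1 /
  \<open>den s\<close> is traded for 1/Q and the other feeds the estimate for spaced fractions; the
  remaining sum over r is at most \<open>L ^ 3\<close>.\<close>

lemma mean_square_high_main_le:
  "(\<Sum>N = 1..K. (cmod (of_nat N * (\<Sum>r\<in>high. A r * B r * unit_char (real N * r))))\<^sup>2)
    \<le> 56 * L ^ 7 * X\<^sup>2 * (X / Q + D) / Q"
proof -
  define c where "c r = A r * B r" for r
  have c: "cmod (c r) \<le> L\<^sup>2 / (real (den r))\<^sup>2" if "r \<in> fractions D" for r
  proof -
    have "cmod (c r) \<le> L / real (den r) * (L / real (den r))"
      unfolding c_def norm_mult using that L_ge_1 by (intro mult_mono norm_A_le norm_B_le) auto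
    then show ?thesis by (simp add: power2_eq_square)
  qed
  have inner: "(\<Sum>s\<in>high. cmod (c s) * geom_bound X (r - s)) \<le> L\<^sup>2 / Q * (56 * L\<^sup>2 * (X / Q + D))" for r
  proof -
    have "(\<Sum>s\<in>high. cmod (c s) * geom_bound X (r - s))
        \<le> (\<Sum>s\<in>high. L\<^sup>2 / Q * (geom_bound X (r - s) / real (den s)))"
    proof (rule sum_mono)
      fix s assume "s \<in> high"
      then have s: "s \<in> fractions D" "Q < real (den s)" by (auto simp: high_def)
      have "cmod (c s) \<le> L\<^sup>2 / (real (den s))\<^sup>2" by (rule c[OF s(1)])
      also have "\<dots> \<le> L\<^sup>2 / (Q * real (den s))"
        using s Q by (intro divide_left_mono) (auto simp: power2_eq_square)
      finally have "cmod (c s) * geom_bound X (r - s) \<le> L\<^sup>2 / (Q * real (den s)) * geom_bound X (r - s)"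
        using D by (intro mult_right_mono geom_bound_nonneg) auto
      then show "cmod (c s) * geom_bound X (r - s) \<le> L\<^sup>2 / Q * (geom_bound X (r - s) / real (den s))"
        by simp
    qed
    also have "\<dots> = L\<^sup>2 / Q * (\<Sum>s\<in>high. geom_bound X (r - s) / real (den s))"
      by (simp only: sum_distrib_left)
    also have "\<dots> \<le> L\<^sup>2 / Q * (56 * L\<^sup>2 * (X / Q + D))"
      using Q by (intro mult_left_mono sum_high_geom_bound_le) auto
    finally show ?thesis .
  qed
  have c_sum: "(\<Sum>r\<in>high. cmod (c r)) \<le> L ^ 3"
  proof -
    have "(\<Sum>r\<in>high. cmod (c r)) \<le> (\<Sum>r\<in>high. L\<^sup>2 / (real (den r))\<^sup>2)"
      by (intro sum_mono c) (simp add: high_def)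
    also have "\<dots> \<le> (\<Sum>r\<in>fractions D. L\<^sup>2 / (real (den r))\<^sup>2)"
      by (intro sum_mono2) (auto simp: high_def)
    also have "\<dots> = L\<^sup>2 * (\<Sum>r\<in>fractions D. 1 / (real (den r))\<^sup>2)"
      by (simp add: sum_distrib_left)
    also have "\<dots> \<le> L\<^sup>2 * L"
      using sum_fractions_inverse_den_sq_le[OF D(1)] ln_D_le by (intro mult_left_mono) auto
    finally show ?thesis by (simp add: power2_eq_square power3_eq_cube)
  qed
  have "complex_of_real (\<Sum>N = 1..K. (cmod (\<Sum>r\<in>high. c r * unit_char (real N * r)))\<^sup>2)
      = (\<Sum>N = 1..K. \<Sum>r\<in>high. \<Sum>s\<in>high. c r * cnj (c s) * unit_char (real N * (r - s)))"
    unfolding of_real_sum complex_norm_square cnj_sum sum_product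
    by (intro sum.cong refl) (simp add: cnj_unit_char algebra_simps flip: unit_char_add)
  also have "\<dots> = (\<Sum>r\<in>high. \<Sum>s\<in>high. c r * cnj (c s) * (\<Sum>N = 1..K. unit_char (real N * (r - s))))"
    unfolding sum_distrib_left by (rule sum_swap3)
  also have "cmod \<dots> \<le> (\<Sum>r\<in>high. \<Sum>s\<in>high. cmod (c r) * (cmod (c s) * geom_bound X (r - s)))"
  proof (intro sum_norm_le)
    fix r s
    show "cmod (c r * cnj (c s) * (\<Sum>N = 1..K. unit_char (real N * (r - s))))
        \<le> cmod (c r) * (cmod (c s) * geom_bound X (r - s))"
      unfolding norm_mult complex_mod_cnj mult.assoc
      by (intro mult_left_mono sum_unit_char_K_le) auto
  qed
  also have "\<dots> = (\<Sum>r\<in>high. cmod (c r) * (\<Sum>s\<in>high. cmod (c s) * geom_bound X (r - s)))"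
    by (simp only: sum_distrib_left)
  also have "\<dots> \<le> (\<Sum>r\<in>high. cmod (c r) * (L\<^sup>2 / Q * (56 * L\<^sup>2 * (X / Q + D))))"
    by (intro sum_mono mult_left_mono inner) auto
  also have "\<dots> = (\<Sum>r\<in>high. cmod (c r)) * (L\<^sup>2 / Q * (56 * L\<^sup>2 * (X / Q + D)))"
    by (simp only: sum_distrib_right)
  also have "\<dots> \<le> L ^ 3 * (L\<^sup>2 / Q * (56 * L\<^sup>2 * (X / Q + D)))"
    using Q D by (intro mult_right_mono c_sum) auto
  finally have *: "(\<Sum>N = 1..K. (cmod (\<Sum>r\<in>high. c r * unit_char (real N * r)))\<^sup>2)
      \<le> L ^ 3 * (L\<^sup>2 / Q * (56 * L\<^sup>2 * (X / Q + D)))"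
    by (simp only: norm_of_real)
  have "(\<Sum>N = 1..K. (cmod (of_nat N * (\<Sum>r\<in>high. A r * B r * unit_char (real N * r))))\<^sup>2)
      \<le> (\<Sum>N = 1..K. X\<^sup>2 * (cmod (\<Sum>r\<in>high. c r * unit_char (real N * r)))\<^sup>2)"
  proof (intro sum_mono)
    fix N assume "N \<in> {1..K}"
    then have "real N \<le> X" using K_le by auto
    then have "(real N)\<^sup>2 \<le> X\<^sup>2" by (intro power_mono) auto
    then show "(cmod (of_nat N * (\<Sum>r\<in>high. A r * B r * unit_char (real N * r))))\<^sup>2
        \<le> X\<^sup>2 * (cmod (\<Sum>r\<in>high. c r * unit_char (real N * r)))\<^sup>2"
      by (simp add: norm_mult power_mult_distrib c_def mult_right_mono)
  qed
  also have "\<dots> = X\<^sup>2 * (\<Sum>N = 1..K. (cmod (\<Sum>r\<in>high. c r * unit_char (real N * r)))\<^sup>2)"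
    by (simp only: sum_distrib_left)
  also have "\<dots> \<le> X\<^sup>2 * (L ^ 3 * (L\<^sup>2 / Q * (56 * L\<^sup>2 * (X / Q + D))))"
    by (intro mult_left_mono *) auto
  also have "\<dots> = 56 * (L ^ 3 * L\<^sup>2 * L\<^sup>2) * X\<^sup>2 * (X / Q + D) / Q"
    by (simp only: times_divide_eq_left times_divide_eq_right mult_ac)
  also have "L ^ 3 * L\<^sup>2 * L\<^sup>2 = L ^ 7" by (simp flip: power_add)
  finally show ?thesis .
qed

text \<open>The convolution of \<open>a_large\<close> with \<open>b_low\<close> is written as that
  of \<open>a\<close> minus that of \<open>a_small\<close>, because the low part of the main term is
  matched against the full \<open>a\<close>.\<close>

lemma weighted_discrepancy_decomposition:
  "weighted_discrepancy l1 l2 f1 f2 D N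
    = (\<Sum>m = 1..<N. a_small m * b (N - m))
      - (\<Sum>m = 1..<N. a_small m * b_low (N - m))
      + (\<Sum>m = 1..<N. a_large m * b_high (N - m))
      + ((\<Sum>m = 1..<N. a m * b_low (N - m)) - of_nat N * (\<Sum>r\<in>low. A r * B r * unit_char (real N * r)))
      - of_nat N * (\<Sum>r\<in>high. A r * B r * unit_char (real N * r))"
proof -
  have "(\<Sum>m = 1..<N. a m * b (N - m)) = (\<Sum>m = 1..<N. a_small m * b (N - m))
      - (\<Sum>m = 1..<N. a_small m * b_low (N - m))
      + (\<Sum>m = 1..<N. a_large m * b_high (N - m)) + (\<Sum>m = 1..<N. a m * b_low (N - m))"
    unfolding sum_subtractf[symmetric] sum.distrib[symmetric]
    by (intro sum.cong refl) (simp add: a_split b_split algebra_simps)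
  moreover have "(\<Sum>r\<in>fractions D. A r * B r * unit_char (real N * r))
      = (\<Sum>r\<in>low. A r * B r * unit_char (real N * r)) + (\<Sum>r\<in>high. A r * B r * unit_char (real N * r))"
    by (subst fractions_split(1), rule sum.union_disjoint) (auto simp: fractions_split)
  ultimately show ?thesis
    unfolding weighted_discrepancy_eq by (simp add: algebra_simps)
qed

text \<open>V is both the size threshold and the bound for each exceptional set. Of the five terms,
  three are controlled on average, each exceeding V for at most V values of N; the other two are at
  most V for every N.\<close>

lemma card_exceptions_le:
  assumes V: "0 < V"
    and small: "4 * D * X * L\<^sup>2 \<le> V * V"
    and small_low: "2 * D * Q * L\<^sup>2 \<le> V"
    and high: "(56 * L ^ 3 * (X / Q + D))\<^sup>2 * second_moment l1 D X \<le> V * V\<^sup>2"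
    and low: "113 * L ^ 4 * Q\<^sup>2 * D \<le> V"
    and tail: "56 * L ^ 7 * X\<^sup>2 * (X / Q + D) / Q \<le> V * V\<^sup>2"
  shows "real (card {N. X / 2 < real N \<and> real N \<le> X \<and>
      \<not> cmod (weighted_discrepancy l1 l2 f1 f2 D N) \<le> 5 * V}) \<le> 3 * V"
proof -
  define E1 where "E1 N = (\<Sum>m = 1..<N. a_small m * b (N - m))" for N
  define E2 where "E2 N = (\<Sum>m = 1..<N. a_large m * b_high (N - m))" for N
  define E3 where "E3 N = of_nat N * (\<Sum>r\<in>high. A r * B r * unit_char (real N * r))" for N
  define S1 where "S1 = {N \<in> {1..K}. V < cmod (E1 N)}"
  define S2 where "S2 = {N \<in> {1..K}. V\<^sup>2 < (cmod (E2 N))\<^sup>2}"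
  define S3 where "S3 = {N \<in> {1..K}. V\<^sup>2 < (cmod (E3 N))\<^sup>2}"
  have "real (card S1) \<le> V"
    unfolding S1_def using V small sum_norm_small_conv_le
    by (intro card_large_values_le) (auto simp: E1_def)
  moreover have "real (card S2) \<le> V"
    unfolding S2_def using V high mean_square_large_high_conv_le
    by (intro card_large_values_le) (auto simp: E2_def)
  moreover have "real (card S3) \<le> V"
    unfolding S3_def using V tail mean_square_high_main_le
    by (intro card_large_values_le) (auto simp: E3_def)
  moreover have "{N. X / 2 < real N \<and> real N \<le> X \<and>
      \<not> cmod (weighted_discrepancy l1 l2 f1 f2 D N) \<le> 5 * V} \<subseteq> S1 \<union> S2 \<union> S3"
  proof (rule subsetI, rule ccontr)
    fix N assume N: "N \<in> {N. X / 2 < real N \<and> real N \<le> X \<and>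
      \<not> cmod (weighted_discrepancy l1 l2 f1 f2 D N) \<le> 5 * V}" "N \<notin> S1 \<union> S2 \<union> S3"
    have "0 < real N" using N(1) D by auto
    then have NK: "1 \<le> N" "N \<in> {1..K}" using N(1) by (auto simp: K_def le_nat_floor)
    have "cmod (E1 N) \<le> V" using N(2) NK by (auto simp: S1_def)
    moreover have "cmod (E2 N) \<le> V" "cmod (E3 N) \<le> V"
      using N(2) NK V by (auto simp: S2_def S3_def not_less intro: power2_le_imp_le)
    moreover note norm_small_low_conv_le[of N] norm_low_conv_minus_main_le[OF NK(1)]
    ultimately have "cmod (weighted_discrepancy l1 l2 f1 f2 D N) \<le> V + V + V + V + V"
      unfolding weighted_discrepancy_decomposition E1_def[symmetric] E2_def[symmetric] E3_def[symmetric]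
      using small_low low
      by (intro norm_triangle_le_diff norm_triangle_le) (smt (verit) norm_triangle_ineq norm_triangle_ineq4)
    then show False using N(1) by auto
  qed
  then have "card {N. X / 2 < real N \<and> real N \<le> X \<and>
      \<not> cmod (weighted_discrepancy l1 l2 f1 f2 D N) \<le> 5 * V} \<le> card (S1 \<union> S2 \<union> S3)"
    by (rule card_mono[rotated]) (auto simp: S1_def S2_def S3_def)
  moreover have "card (S1 \<union> S2 \<union> S3) \<le> card S1 + card S2 + card S3"
    by (meson add_right_mono card_Un_le order_trans)
  ultimately show ?thesis by linarith
qed

end

section \<open>Choice of parameters\<close>

text \<open>A logarithmic factor p <= u costs one power of u.\<close>

lemma absorb_power:
  fixes u p :: real
  assumes "1 \<le> u" "p \<le> u" "k < n"
  shows "p / u ^ n \<le> 1 / u ^ k"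
proof -
  have "p * u ^ k \<le> u * u ^ k" using assms by (intro mult_right_mono) auto
  also have "\<dots> = u ^ Suc k" by simp
  also have "\<dots> \<le> u ^ n" using assms by (intro power_increasing) auto
  finally show ?thesis using assms by (simp add: field_simps)
qed

text \<open>With u = \<open>X powr (\<epsilon> / 32)\<close>, D = X / u^32, Q = u^8 and V = X / u^4,
  every condition compares powers of u, with at least one power to spare for constants and
  logarithms. The factor \<open>X powr (\<eta> X)\<close> also costs at most one u.\<close>

lemma card_exceptions_powr_le:
  fixes \<epsilon> C X :: real and \<eta> :: "real \<Rightarrow> real"
  assumes \<epsilon>: "0 < \<epsilon>" "\<epsilon> \<le> 1" and X: "2 \<le> X" and \<eta>: "\<eta> X \<le> \<epsilon> / 32"
    and large: "12544 * (1 + \<bar>C\<bar>) * (1 + ln X) ^ 7 \<le> X powr (\<epsilon> / 32)"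
    and moment: "second_moment l1 (X powr (1 - \<epsilon>)) X \<le> C * X powr (1 + \<eta> X)"
    and f1: "\<forall>n \<ge> 1. cmod (f1 n) \<le> 1" and f2: "\<forall>n \<ge> 1. cmod (f2 n) \<le> 1"
  shows "real (card {N. X / 2 < real N \<and> real N \<le> X \<and>
      \<not> cmod (weighted_discrepancy l1 l2 f1 f2 (X powr (1 - \<epsilon>)) N) \<le> 5 * X powr (1 - \<epsilon> / 8)})
    \<le> 3 * X powr (1 - \<epsilon> / 8)"
proof -
  define u where "u = X powr (\<epsilon> / 32)"
  define D where "D = X powr (1 - \<epsilon>)"
  define V where "V = X powr (1 - \<epsilon> / 8)"
  have u: "1 \<le> u" using X \<epsilon> by (simp add: u_def ge_one_powr_ge_zero)
  have u_power: "u ^ k = X powr (real k * (\<epsilon> / 32))" for k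
    using X by (simp add: u_def powr_power mult.commute)
  have D_eq: "D = X / u ^ 32" using X by (simp add: D_def u_power powr_diff)
  have V_eq: "V = X / u ^ 4" using X by (simp add: V_def u_power powr_diff)
  interpret progression_pair l1 l2 f1 f2 X D "u ^ 8"
  proof
    show "1 \<le> u ^ 8" using u by (rule one_le_power)
    show "1 \<le> D" using X \<epsilon> by (simp add: D_def ge_one_powr_ge_zero)
    have "X powr (1 - \<epsilon>) \<le> X powr 1" using X \<epsilon> by (intro powr_mono) auto
    then show "D \<le> X" using X by (simp add: D_def)
  qed (use f1 f2 in auto)
  have L_power: "L ^ k \<le> L ^ 7" if "k \<le> 7" for k
    using that L_ge_1 by (rule power_increasing)
  have L7: "12544 * (1 + \<bar>C\<bar>) * L ^ 7 \<le> u" using large by (simp add: u_def L_def)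
  \<comment> \<open>The constants that occur are 4, 2, 113, 112 and 12544 |C|, with logarithms up to
    the seventh power. Here 12544 = 112^2 comes from squaring 56 (X/Q + D) <= 112 X/Q.\<close>
  have absorb: "p * L ^ k \<le> u" if "0 \<le> p" "p \<le> 12544 * (1 + \<bar>C\<bar>)" "k \<le> 7" for p k
  proof -
    have "p * L ^ k \<le> 12544 * (1 + \<bar>C\<bar>) * L ^ 7"
      using that L_power[of k] L_ge_1 by (intro mult_mono) auto
    with L7 show ?thesis by linarith
  qed
  have sum_le: "X / u ^ 8 + D \<le> 2 * X / u ^ 8"
  proof -
    have "X / u ^ 32 \<le> X / u ^ 8" using X u by (intro divide_left_mono power_increasing) auto
    then show ?thesis unfolding D_eq by simp
  qed
  have D_cancel: "D * p = X / q" if "q * p = u ^ 32" for p q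
  proof -
    have "q * p \<noteq> 0" using that u by simp
    then show ?thesis unfolding D_eq that[symmetric] by simp
  qed
  have "4 * L\<^sup>2 / u ^ 32 \<le> 1 / u ^ 8"
    using u by (intro absorb_power absorb) auto
  then have "X\<^sup>2 * (4 * L\<^sup>2 / u ^ 32) \<le> X\<^sup>2 * (1 / u ^ 8)" by (intro mult_left_mono) auto
  then have small: "4 * D * X * L\<^sup>2 \<le> V * V"
    unfolding D_eq V_eq by (simp add: power2_eq_square mult_ac flip: power_add)
  have "2 * L\<^sup>2 / u ^ 24 \<le> 1 / u ^ 4"
    using u by (intro absorb_power absorb) auto
  then have "X * (2 * L\<^sup>2 / u ^ 24) \<le> X * (1 / u ^ 4)" using X by (intro mult_left_mono) auto
  moreover have "2 * D * u ^ 8 * L\<^sup>2 = X * (2 * L\<^sup>2 / u ^ 24)"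
  proof -
    have "D * u ^ 8 = X / u ^ 24"
      by (rule D_cancel) (simp flip: power_add)
    moreover have "2 * D * u ^ 8 * L\<^sup>2 = 2 * L\<^sup>2 * (D * u ^ 8)" by simp
    ultimately show ?thesis by simp
  qed
  ultimately have small_low: "2 * D * u ^ 8 * L\<^sup>2 \<le> V" unfolding V_eq by simp
  have "113 * L ^ 4 / u ^ 16 \<le> 1 / u ^ 4"
    using u by (intro absorb_power absorb) auto
  then have "X * (113 * L ^ 4 / u ^ 16) \<le> X * (1 / u ^ 4)" using X by (intro mult_left_mono) auto
  moreover have "113 * L ^ 4 * (u ^ 8)\<^sup>2 * D = X * (113 * L ^ 4 / u ^ 16)"
  proof -
    have "D * (u ^ 8)\<^sup>2 = X / u ^ 16"
      by (rule D_cancel) (simp flip: power_add power_mult)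
    moreover have "113 * L ^ 4 * (u ^ 8)\<^sup>2 * D = 113 * L ^ 4 * (D * (u ^ 8)\<^sup>2)"
      by (simp only: mult_ac)
    ultimately show ?thesis by simp
  qed
  ultimately have low: "113 * L ^ 4 * (u ^ 8)\<^sup>2 * D \<le> V" unfolding V_eq by simp
  have V3: "V * V\<^sup>2 = X ^ 3 * (1 / u ^ 12)"
    unfolding V_eq by (simp add: power_divide power2_eq_square power3_eq_cube flip: power_add)
  have high: "(56 * L ^ 3 * (X / u ^ 8 + D))\<^sup>2 * second_moment l1 D X \<le> V * V\<^sup>2"
  proof -
    have "second_moment l1 D X \<le> C * X powr (1 + \<eta> X)" using moment by (simp add: D_def)
    also have "\<dots> \<le> \<bar>C\<bar> * X powr (1 + \<eta> X)" by (intro mult_right_mono) auto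
    also have "\<dots> \<le> \<bar>C\<bar> * X powr (1 + \<epsilon> / 32)"
      using X \<eta> by (intro mult_left_mono powr_mono) auto
    also have "\<dots> = \<bar>C\<bar> * (X * u)" using X by (simp add: u_def powr_add)
    finally have "(56 * L ^ 3 * (X / u ^ 8 + D))\<^sup>2 * second_moment l1 D X
        \<le> (56 * L ^ 3 * (X / u ^ 8 + D))\<^sup>2 * (\<bar>C\<bar> * (X * u))"
      by (intro mult_left_mono) auto
    also have "\<dots> \<le> (56 * L ^ 3 * (2 * X / u ^ 8))\<^sup>2 * (\<bar>C\<bar> * (X * u))"
      using X u L_ge_1 D sum_le by (intro mult_right_mono power_mono mult_left_mono) auto
    also have "\<dots> = X ^ 3 * (12544 * \<bar>C\<bar> * L ^ 6 / u ^ 15)"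
    proof -
      have "(u ^ 8)\<^sup>2 = u * u ^ 15" by (simp flip: power_Suc power_mult)
      moreover have "(L ^ 3)\<^sup>2 = L ^ 6" by (simp flip: power_mult)
      moreover have "(56 * l * (2 * X / v))\<^sup>2 * (\<bar>C\<bar> * (X * u)) = X ^ 3 * (12544 * \<bar>C\<bar> * l\<^sup>2 / w)"
        if "v\<^sup>2 = u * w" for l v w :: real
        using u by (simp add: power_mult_distrib power_divide that power2_eq_square[of X] power3_eq_cube[of X])
      ultimately show ?thesis by metis
    qed
    also have "\<dots> \<le> X ^ 3 * (1 / u ^ 12)"
      using X u by (intro mult_left_mono absorb_power absorb) auto
    finally show ?thesis unfolding V3 .
  qed
  have tail: "56 * L ^ 7 * X\<^sup>2 * (X / u ^ 8 + D) / u ^ 8 \<le> V * V\<^sup>2"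
  proof -
    have "56 * L ^ 7 * X\<^sup>2 * (X / u ^ 8 + D) / u ^ 8 \<le> 56 * L ^ 7 * X\<^sup>2 * (2 * X / u ^ 8) / u ^ 8"
      using u L_ge_1 sum_le by (intro divide_right_mono mult_left_mono) auto
    also have "\<dots> = X ^ 3 * (112 * L ^ 7 / u ^ 16)"
      by (simp add: power2_eq_square power3_eq_cube flip: power_add)
    also have "\<dots> \<le> X ^ 3 * (1 / u ^ 12)"
      using X u by (intro mult_left_mono absorb_power absorb) auto
    finally show ?thesis unfolding V3 .
  qed
  have "0 < V" using X by (simp add: V_def)
  from card_exceptions_le[OF this small small_low high low tail]
  show ?thesis by (simp add: D_def V_def)
qed

lemma card_nat_interval_le:
  assumes "0 \<le> X"
  shows "real (card {N. X / 2 < real N \<and> real N \<le> X \<and> P N}) \<le> X"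
proof -
  have "card {N. X / 2 < real N \<and> real N \<le> X \<and> P N} \<le> card {1..nat \<lfloor>X\<rfloor>}"
    using assms by (intro card_mono) (auto simp: le_nat_floor Suc_le_eq intro: gr0I)
  then have "real (card {N. X / 2 < real N \<and> real N \<le> X \<and> P N}) \<le> real (nat \<lfloor>X\<rfloor>)" by simp
  also have "\<dots> \<le> X" using assms by simp
  finally show ?thesis .
qed

theorem theorem2p11:
  fixes \<epsilon> C :: real and \<eta> :: "real \<Rightarrow> real"
  assumes "\<epsilon> > 0" and "(\<eta> \<longlongrightarrow> 0) at_top"
  shows "\<exists>K1 K2 :: real. \<forall>X \<ge> 2. \<forall>(l1 :: nat \<Rightarrow> int) (l2 :: nat \<Rightarrow> int)
           (f1 :: nat \<Rightarrow> complex) (f2 :: nat \<Rightarrow> complex).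
           (let D = X powr (1 - \<epsilon>) in
             (second_moment l1 D X \<le> C * X powr (1 + \<eta> X) \<or>
              second_moment l2 D X \<le> C * X powr (1 + \<eta> X)) \<longrightarrow>
             (\<forall>n \<ge> 1. cmod (f1 n) \<le> 1) \<longrightarrow>
             (\<forall>n \<ge> 1. cmod (f2 n) \<le> 1) \<longrightarrow>
             real (card {N :: nat. X / 2 < real N \<and> real N \<le> X \<and>
                \<not> cmod (weighted_discrepancy l1 l2 f1 f2 D N) \<le> K2 * X powr (1 - \<epsilon> / 8)})
             \<le> K1 * X powr (1 - \<epsilon> / 8))"
proof (cases "\<epsilon> \<le> 1")
  case False
  \<comment> \<open>For \<epsilon> > 1 one has D < 1, so there are no moduli, the discrepancy
    vanishes and both constants can be 0.\<close>
  have "weighted_discrepancy l1 l2 f1 f2 (X powr (1 - \<epsilon>)) N = 0" if "2 \<le> X" for l1 l2 f1 f2 X N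
  proof -
    have "X powr (1 - \<epsilon>) < X powr 0" using False that by (intro powr_less_mono) auto
    then have "{d. 1 \<le> d \<and> real d \<le> X powr (1 - \<epsilon>)} = {}" using that by auto
    then show ?thesis unfolding weighted_discrepancy_def by (simp only: sum.empty)
  qed
  then show ?thesis by (intro exI[of _ 0]) (simp add: Let_def)
next
  case True
  have "((\<lambda>X. (1 + ln X) ^ 7 / X powr (\<epsilon> / 32)) \<longlongrightarrow> 0) at_top"
    using assms(1) by real_asymp
  then have "\<forall>\<^sub>F X in at_top. (1 + ln X) ^ 7 / X powr (\<epsilon> / 32) < 1 / (12544 * (1 + \<bar>C\<bar>))"
    by (rule order_tendstoD) simp
  moreover have "\<forall>\<^sub>F X in at_top. \<eta> X < \<epsilon> / 32"
    using assms by (intro order_tendstoD[OF assms(2)]) auto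
  ultimately have "\<forall>\<^sub>F X in at_top. (1 + ln X) ^ 7 / X powr (\<epsilon> / 32) < 1 / (12544 * (1 + \<bar>C\<bar>))
      \<and> \<eta> X < \<epsilon> / 32"
    by (rule eventually_conj)
  \<comment> \<open>The threshold depends only on \<epsilon>, C and \<eta>, hence is uniform in the
    sequences and weights.\<close>
  then obtain X0 where X0: "\<And>X. X0 \<le> X \<Longrightarrow> (1 + ln X) ^ 7 / X powr (\<epsilon> / 32) < 1 / (12544 * (1 + \<bar>C\<bar>))"
      "\<And>X. X0 \<le> X \<Longrightarrow> \<eta> X < \<epsilon> / 32"
    unfolding eventually_at_top_linorder by blast
  \<comment> \<open>The 3 serves X >= X0. Below X0 the trivial count X is X^(\<epsilon>/8) times the
    target, which accounts for the second entry.\<close>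
  define K1 where "K1 = max 3 (X0 powr (\<epsilon> / 8))"
  have "real (card {N. X / 2 < real N \<and> real N \<le> X \<and>
        \<not> cmod (weighted_discrepancy l1 l2 f1 f2 (X powr (1 - \<epsilon>)) N) \<le> 5 * X powr (1 - \<epsilon> / 8)})
      \<le> K1 * X powr (1 - \<epsilon> / 8)"
    if X: "2 \<le> X" and m: "second_moment l1 (X powr (1 - \<epsilon>)) X \<le> C * X powr (1 + \<eta> X) \<or>
        second_moment l2 (X powr (1 - \<epsilon>)) X \<le> C * X powr (1 + \<eta> X)"
      and f: "\<forall>n \<ge> 1. cmod (f1 n) \<le> 1" "\<forall>n \<ge> 1. cmod (f2 n) \<le> 1" for X l1 l2 f1 f2
  proof (cases "X0 \<le> X")
    case False
    have "real (card {N. X / 2 < real N \<and> real N \<le> X \<and>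
        \<not> cmod (weighted_discrepancy l1 l2 f1 f2 (X powr (1 - \<epsilon>)) N) \<le> 5 * X powr (1 - \<epsilon> / 8)}) \<le> X"
      using X by (intro card_nat_interval_le) auto
    also have "\<dots> = X powr (\<epsilon> / 8) * X powr (1 - \<epsilon> / 8)"
      using X by (simp flip: powr_add)
    also have "\<dots> \<le> X0 powr (\<epsilon> / 8) * X powr (1 - \<epsilon> / 8)"
      using X False assms(1) by (intro mult_right_mono powr_mono2) auto
    also have "\<dots> \<le> K1 * X powr (1 - \<epsilon> / 8)"
      by (intro mult_right_mono) (auto simp: K1_def)
    finally show ?thesis .
  next
    case True
    have \<eta>: "\<eta> X \<le> \<epsilon> / 32" using X0(2)[OF True] by simp
    have large: "12544 * (1 + \<bar>C\<bar>) * (1 + ln X) ^ 7 \<le> X powr (\<epsilon> / 32)"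
      using X0(1)[OF True] X by (simp add: field_simps)
    have "real (card {N. X / 2 < real N \<and> real N \<le> X \<and>
        \<not> cmod (weighted_discrepancy l1 l2 f1 f2 (X powr (1 - \<epsilon>)) N) \<le> 5 * X powr (1 - \<epsilon> / 8)})
      \<le> 3 * X powr (1 - \<epsilon> / 8)"
      using m
    proof
      assume "second_moment l1 (X powr (1 - \<epsilon>)) X \<le> C * X powr (1 + \<eta> X)"
      then show ?thesis
        using assms(1) \<open>\<epsilon> \<le> 1\<close> X \<eta> large f by (intro card_exceptions_powr_le)
    next
      assume "second_moment l2 (X powr (1 - \<epsilon>)) X \<le> C * X powr (1 + \<eta> X)"
      then show ?thesis
        unfolding weighted_discrepancy_commute[of l1]
        using assms(1) \<open>\<epsilon> \<le> 1\<close> X \<eta> large f by (intro card_exceptions_powr_le)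
    qed
    also have "\<dots> \<le> K1 * X powr (1 - \<epsilon> / 8)"
      by (intro mult_right_mono) (auto simp: K1_def)
    finally show ?thesis .
  qed
  then show ?thesis unfolding Let_def by blast
qed

end
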